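(* Let $L\ge1$ and $0<\varepsilon\leq 1$. Let $\mathfrak{f}(\delta,s)$ be an arbitrary (deterministic) continuous function that vanishes as $\delta\to0$. Let $\mathcal{B}(s)=e^{\mathfrak{f}(\delta,s)+\omega_{\delta,L,\varepsilon}(s)}-1$, where $\omega_{\delta,L,\varepsilon}$ is the infinitely divisible field of intermittency $\delta>0$ defined in the context. Then, given any distinct $0<s_1<\cdots<s_n<1$, $n\ge2$, as $\delta\to0$: if $n=2$, $$\mathbf{E}\bigl[\mathcal{B}(s_1)\mathcal{B}(s_2)\bigr]=\bigl(e^{\mathfrak{f}(\delta,s_1)}-1\bigr)\bigl(e^{\mathfrak{f}(\delta,s_2)}-1\bigr)+\delta\,\rho_{L,\varepsilon}(s_2-s_1)\Bigl(\sigma^2+\int_{\mathbb{R}\setminus\{0\}}(e^u-1)^2\,d\mathcal{M}(u)\Bigr)+o(\delta),$$ and if $n>2$, $$\mathbf{E}\bigl[\mathcal{B}(s_1)\cdots\mathcal{B}(s_n)\bigr]=\bigl(e^{\mathfrak{f}(\delta,s_1)}-1\bigr)\cdots\bigl(e^{\mathfrak{f}(\delta,s_n)}-1\bigr)+\delta\,\rho_{L,\varepsilon}(s_n-s_1)\int_{\mathbb{R}\setminus\{0\}}(e^u-1)^n\,d\mathcal{M}(u)+o(\delta).$$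
   Context: **Infinitely divisible exponent.** Let $\sigma^2\ge 0$ and let $\mathcal{M}$ be a Lévy spectral function: continuous and non-decreasing on $(-\infty,0)$ and on $(0,\infty)$, with $\int_{[-1,1]\setminus\{0\}}u^2\,d\mathcal{M}(u)<\infty$ and $\lim_{u\to\pm\infty}\mathcal{M}(u)=0$. It is assumed that $\mathcal{M}$ decays fast enough at infinity that all integrals with respect to $d\mathcal{M}$ that are used converge (in particular the exponential moments needed for $\mathbf{E}[\mathcal{B}(s_1)\cdots\mathcal{B}(s_n)]$ to be finite). (The pure point mass case $d\mathcal{M}(u)=\delta(u-\log c)\,du$, $c>0$, $c\ne1$, is also allowed.) Put $$\phi(q)=-\frac{iq\sigma^2}{2}-\frac{q^2\sigma^2}{2}+\int_{\mathbb{R}\setminus\{0\}}\bigl(e^{iqu}-1-iq(e^u-1)\bigr)\,d\mathcal{M}(u),$$ so that $\phi(-i)=0$. **Intensity measure.** Let $r$ be positive, smooth and even on $(-1,0)\cup(0,1)$ (with the one-sided values of $r$ and $r'$ at $1$ existing and $r(1)=1$), with $\lim_{t\to0^+}t\frac{d}{dt}\log r(t)=1$. Define $f(l)=-l^2\frac{d^2}{dl^2}\log r(l)$ for $l\in(0,1)$ and $f(l)=\frac{d}{dz}\big|_{z=1}\log r(z)$ for $l\ge1$, and assume $f>0$. (The Bacry–Muzy case is $r(t)=|t|$, $f=1$.) Let $\rho(dt\,dl)=\frac{f(l)}{l^2}\,dt\,dl$ on $\mathbb{H}_+=\{(t,l):l>0\}$. **The field.** For intermittency $\mu>0$ let $P$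 be an infinitely divisible independently scattered random measure on $\mathbb{H}_+$: $P(A)$ and $P(B)$ are independent for disjoint $A,B$, and $\mathbf{E}[e^{iqP(A)}]=e^{\mu\phi(q)\rho(A)}$ for $q\in\mathbb{R}$. For $0<\varepsilon\le1$ let $$\mathcal{A}_\varepsilon(u)=\Bigl\{(t,l): |t-u|\le \tfrac{l}{2}\text{ for }\varepsilon\le l\le 1,\ \ |t-u|\le\tfrac12\text{ for }l\ge1\Bigr\},$$ and $\omega_{\mu,\varepsilon}(u)=P(\mathcal{A}_\varepsilon(u))$. One has $\rho(\mathcal{A}_\varepsilon(u)\cap\mathcal{A}_\varepsilon(v))=\rho_\varepsilon(u-v)$, where $\rho_\varepsilon(u)=-\log r(u)$ if $\varepsilon\le|u|\le1$, $\rho_\varepsilon(u)=-\log r(\varepsilon)+\bigl(1-\frac{|u|}{\varepsilon}\bigr)\varepsilon\frac{d}{d\varepsilon}\log r(\varepsilon)$ if $|u|<\varepsilon$, and $\rho_\varepsilon(u)=0$ if $|u|>1$. **The extended field.** For $L\ge1$ let $Z_L$ be a random variable independent of the process $\omega_{\mu,\varepsilon}$ with $\mathbf{E}[e^{iqZ_L}]=e^{\mu\phi(q)\log L}$, and set $\omega_{\mu,L,\varepsilon}(u)=\omega_{\mu,\varepsilon}(u)+Z_L$; $\omega_{\delta,L,\varepsilon}$ is this field with intermittency $\mu=\delta$. Also $\rho_{L,\varepsilon}(u)=\log L+\rho_\varepsilon(u)$. *)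

theory Defs
  imports "HOL-Probability.Probability"
begin

definition levy_stieltjes :: "(real \<Rightarrow> real) \<Rightarrow> real measure" where
  (* The Lebesgue-Stieltjes measure of M on the space - {0}, obtained in the same way as
     interval_measure, but from half-open intervals that stay on one side of 0, since M may be
     unbounded near 0.  Integrals against it are integrals over - {0}. *)
  "levy_stieltjes M = extend_measure (- {0}) {(a, b). a \<le> b \<and> (b < 0 \<or> 0 < a)}
     (\<lambda>(a, b). {a<..b}) (\<lambda>(a, b). ennreal (M b - M a))"

lemma emeasure_levy_stieltjes:
  assumes c: "continuous_on {..<0} M" "continuous_on {0<..} M"
    and m: "mono_on {..<0} M" "mono_on {0<..} M"
    and ab: "a \<le> b" "b < 0 \<or> 0 < a"
  shows "emeasure (levy_stieltjes M) {a<..b} = ennreal (M b - M a)"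
proof -
  define e :: "nat \<Rightarrow> real" where "e k = 1 / real (Suc k)" for k
  have e: "0 < e k" "e (Suc k) \<le> e k" for k by (auto simp: e_def field_simps)
  define T where "T k x = M (max x (e k)) + M (min x (- e k))" for k x
  define D where "D k x = (case k of 0 \<Rightarrow> T 0 x | Suc j \<Rightarrow> T (Suc j) x - T j x)" for k x
  have sumD: "(\<Sum>k\<le>K. D k x) = T K x" for K x
    by (induction K) (auto simp: D_def)
  have contT: "continuous_on UNIV (T k)" for k
    unfolding T_def using e(1)[of k]
    by (intro continuous_intros continuous_on_compose2[OF c(1)] continuous_on_compose2[OF c(2)])
       (auto simp: less_max_iff_disj min_less_iff_disj)
  have contD: "continuous_on UNIV (D k)" for k
    unfolding D_def using contT by (cases k) (auto intro!: continuous_intros)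
  have mD: "D k x \<le> D k y" if "x \<le> y" for k x y
  proof (cases k)
    case 0
    have "M (max x (e 0)) \<le> M (max y (e 0))" "M (min x (- e 0)) \<le> M (min y (- e 0))"
      subgoal using that e(1)[of 0] by (intro mono_onD[OF m(2)]) auto
      subgoal using that e(1)[of 0] by (intro mono_onD[OF m(1)]) auto
      done
    then show ?thesis by (simp add: 0 D_def T_def)
  next
    case (Suc j)
    have 1: "M (max x (e (Suc j))) - M (max x (e j)) \<le> M (max y (e (Suc j))) - M (max y (e j))"
    proof (cases "x \<le> e j")
      case True
      have "M (max x (e (Suc j))) \<le> M (max (min y (e j)) (e (Suc j)))"
        using that True e(1)[of j] e(1)[of "Suc j"] by (intro mono_onD[OF m(2)]) auto
      moreover have "M (max (min y (e j)) (e (Suc j))) - M (e j) = M (max y (e (Suc j))) - M (max y (e j))"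
        using e(2)[of j] by (auto simp: max_def min_def)
      ultimately show ?thesis using True by (simp add: max_def)
    next
      case False then show ?thesis using that e(2)[of j] by (simp add: max_def)
    qed
    have 2: "M (min x (- e (Suc j))) - M (min x (- e j)) \<le> M (min y (- e (Suc j))) - M (min y (- e j))"
    proof (cases "x \<le> - e j")
      case True
      have "0 \<le> M (min y (- e (Suc j))) - M (min y (- e j))"
        using e(1)[of j] e(1)[of "Suc j"] e(2)[of j] by (simp, intro mono_onD[OF m(1)]) auto
      then show ?thesis using True e(2)[of j] by (simp add: min_def)
    next
      case False
      have "M (min x (- e (Suc j))) \<le> M (min y (- e (Suc j)))"
        using that e(1)[of "Suc j"] by (intro mono_onD[OF m(1)]) auto
      then show ?thesis using False that by (simp add: min_def)
    qed
    show ?thesis using 1 2 by (simp add: Suc D_def T_def)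
  qed
  define N where "N k = interval_measure (D k)" for k
  have N: "emeasure (N k) {x<..y} = ennreal (D k y - D k x)" if "x \<le> y" for k x y
    unfolding N_def using contD mD that
    by (intro emeasure_interval_measure_Ioc) (auto simp: continuous_on_eq_continuous_within continuous_at_imp_continuous_at_within)
  define mu where "mu A = (\<Sum>k. emeasure (N k) A)" for A
  have S: "A \<in> sets borel" if "A \<in> sets (levy_stieltjes M)" for A
  proof -
    have "A \<in> sigma_sets (- {0}) ((\<lambda>(a, b). {a<..b}) ` {(a, b). a \<le> b \<and> (b < 0 \<or> 0 < (a::real))})"
      using that unfolding levy_stieltjes_def by (subst (asm) sets_extend_measure) auto
    then show ?thesis
      by (induction rule: sigma_sets.induct) auto
  qed
  show ?thesis
  proof (rule emeasure_extend_measure_Pair[where \<mu>' = mu, OF levy_stieltjes_def])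
    fix x y :: real assume xy: "x \<le> y \<and> (y < 0 \<or> 0 < x)"
    then show "{x<..y} \<in> Pow (- {0})" by auto
    have "(\<lambda>k. D k y - D k x) sums (M y - M x)"
    proof -
      have "eventually (\<lambda>K. T K y - T K x = M y - M x) sequentially"
      proof -
        have "e \<longlonglongrightarrow> 0" unfolding e_def by (rule LIMSEQ_Suc[OF lim_1_over_n])
        moreover have "0 < (if y < 0 then - y else x)" using xy by auto
        ultimately have "eventually (\<lambda>K. e K < (if y < 0 then - y else x)) sequentially"
          by (rule order_tendstoD)
        then show ?thesis
        proof eventually_elim
          case (elim K)
          then show ?case using xy e(1)[of K]
            by (auto simp: T_def max_def min_def split: if_splits)
        qed
      qed
      then have "(\<lambda>K. T K y - T K x) \<longlonglongrightarrow> M y - M x" by (rule tendsto_eventually)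
      then show ?thesis unfolding sums_def_le by (simp add: sum_subtractf sumD)
    qed
    then show "mu {x<..y} = ennreal (M y - M x)"
      unfolding mu_def using xy mD by (auto simp: N intro!: suminf_ennreal_eq)
  next
    show "positive (sets (levy_stieltjes M)) mu" by (simp add: positive_def mu_def)
    show "countably_additive (sets (levy_stieltjes M)) mu"
    proof (rule countably_additiveI)
      fix A :: "nat \<Rightarrow> real set"
      assume A: "range A \<subseteq> sets (levy_stieltjes M)" "disjoint_family A"
      have "(\<Sum>i. mu (A i)) = (\<Sum>k. \<Sum>i. emeasure (N k) (A i))"
        unfolding mu_def
        using nn_integral_suminf[of "\<lambda>k i. emeasure (N k) (A i)" "count_space (UNIV :: nat set)"]
        by (simp add: nn_integral_count_space_nat)
      also have "\<dots> = mu (\<Union>i. A i)"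
        unfolding mu_def using A S by (intro suminf_cong suminf_emeasure) (auto simp: N_def)
      finally show "(\<Sum>i. mu (A i)) = mu (\<Union>i. A i)" .
    qed
  qed (use ab in auto)
qed

definition levy_spectral_function :: "(real \<Rightarrow> real) \<Rightarrow> bool" where
  "levy_spectral_function M \<longleftrightarrow>
     continuous_on {..<0} M \<and> continuous_on {0<..} M \<and>
     mono_on {..<0} M \<and> mono_on {0<..} M \<and>
     set_integrable (levy_stieltjes M) ({-1..1} - {0}) (\<lambda>u. u\<^sup>2) \<and>
     (M \<longlongrightarrow> 0) at_bot \<and> (M \<longlongrightarrow> 0) at_top"

definition levy_spectral_measure :: "real measure \<Rightarrow> bool" where
  (* nu is dM for a Levy spectral function M, or a unit point mass at log c. *)
  "levy_spectral_measure \<nu> \<longleftrightarrow>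
     (\<exists>M. levy_spectral_function M \<and> \<nu> = levy_stieltjes M) \<or>
     (\<exists>c>0. c \<noteq> 1 \<and> \<nu> = return (restrict_space borel (- {0})) (ln c))"

definition levy_exponent :: "real \<Rightarrow> real measure \<Rightarrow> complex \<Rightarrow> complex" where
  "levy_exponent \<sigma> \<nu> q =
     - (\<i> * q * of_real (\<sigma>\<^sup>2)) / 2 - q\<^sup>2 * of_real (\<sigma>\<^sup>2) / 2 +
     (LINT u|\<nu>. (exp (\<i> * q * of_real u) - 1 - \<i> * q * (of_real (exp u) - 1)))"

definition dlog :: "(real \<Rightarrow> real) \<Rightarrow> real \<Rightarrow> real" where
  (* Left derivative of log r.  For 0 < t < 1 it is the ordinary derivative; at t = 1, where r
     is only constrained from the left, it is the one-sided one. *)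
  "dlog r t = vector_derivative (\<lambda>z. ln (r z)) (at_left t)"

definition intensity_density :: "(real \<Rightarrow> real) \<Rightarrow> real \<Rightarrow> real" where
  "intensity_density r l =
     (if l < 1 then - l\<^sup>2 * deriv (deriv (\<lambda>z. ln (r z))) l else dlog r 1)"

definition admissible_profile :: "(real \<Rightarrow> real) \<Rightarrow> bool" where
  "admissible_profile r \<longleftrightarrow>
     (\<forall>t. 0 < \<bar>t\<bar> \<and> \<bar>t\<bar> < 1 \<longrightarrow>
        r t > 0 \<and> r (- t) = r t \<and> (\<forall>k. (deriv ^^ k) r field_differentiable at t)) \<and>
     (r \<longlongrightarrow> 1) (at_left 1) \<and> r 1 = 1 \<and> (\<exists>d. (deriv r \<longlongrightarrow> d) (at_left 1)) \<and>
     ((\<lambda>t. t * deriv (\<lambda>z. ln (r z)) t) \<longlongrightarrow> 1) (at_right 0) \<and>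
     (\<forall>l>0. intensity_density r l > 0)"

definition intensity :: "(real \<Rightarrow> real) \<Rightarrow> (real \<times> real) measure" where
  "intensity r = density (restrict_space lborel {(t, l). 0 < l})
     (\<lambda>(t, l). ennreal (intensity_density r l / l\<^sup>2))"

definition id_random_measure ::
  "'a measure \<Rightarrow> 'b measure \<Rightarrow> real \<Rightarrow> (complex \<Rightarrow> complex) \<Rightarrow> ('b set \<Rightarrow> 'a \<Rightarrow> real) \<Rightarrow> bool" where
  (* P is an independently scattered random measure on the sets of finite control measure rho,
     with E exp(iqP(A)) = exp(mu phi(q) rho(A)).  Independence is joint independence along
     disjoint sequences, and additivity is the usual almost sure countable additivity. *)
  "id_random_measure \<Omega> \<rho> \<mu> \<phi> P \<longleftrightarrow>
     prob_space \<Omega> \<and>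
     (\<forall>A. range A \<subseteq> {A \<in> sets \<rho>. emeasure \<rho> A < \<infinity>} \<and> disjoint_family A \<longrightarrow>
        prob_space.indep_vars \<Omega> (\<lambda>_. borel) (\<lambda>i::nat. P (A i)) UNIV \<and>
        (emeasure \<rho> (\<Union>i. A i) < \<infinity> \<longrightarrow> (AE x in \<Omega>. (\<lambda>i. P (A i) x) sums P (\<Union>i. A i) x))) \<and>
     (\<forall>A \<in> sets \<rho>. emeasure \<rho> A < \<infinity> \<longrightarrow> (\<forall>q.
        char (distr \<Omega> borel (P A)) q = exp (of_real \<mu> * \<phi> (of_real q) * of_real (measure \<rho> A))))"

definition cone :: "real \<Rightarrow> real \<Rightarrow> (real \<times> real) set" where
  "cone \<epsilon> u = {(t, l). (\<epsilon> \<le> l \<and> l \<le> 1 \<and> \<bar>t - u\<bar> \<le> l / 2) \<or> (1 \<le> l \<and> \<bar>t - u\<bar> \<le> 1 / 2)}"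

definition id_field :: "((real \<times> real) set \<Rightarrow> 'a \<Rightarrow> real) \<Rightarrow> real \<Rightarrow> real \<Rightarrow> 'a \<Rightarrow> real" where
  "id_field P \<epsilon> u = P (cone \<epsilon> u)"

definition independent_of_process ::
  "'a measure \<Rightarrow> ('a \<Rightarrow> real) \<Rightarrow> (real \<Rightarrow> 'a \<Rightarrow> real) \<Rightarrow> bool" where
  "independent_of_process \<Omega> Z W \<longleftrightarrow>
     prob_space.indep_set \<Omega> (sets (vimage_algebra (space \<Omega>) Z borel))
       (sets (vimage_algebra (space \<Omega>) (\<lambda>x u. W u x) (Pi\<^sub>M UNIV (\<lambda>_. borel))))"

definition extension_variable ::
  "'a measure \<Rightarrow> real \<Rightarrow> (complex \<Rightarrow> complex) \<Rightarrow> real \<Rightarrow> (real \<Rightarrow> 'a \<Rightarrow> real) \<Rightarrow> ('a \<Rightarrow> real) \<Rightarrow> bool"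
  where
  "extension_variable \<Omega> \<mu> \<phi> L W Z \<longleftrightarrow>
     Z \<in> borel_measurable \<Omega> \<and> independent_of_process \<Omega> Z W \<and>
     (\<forall>q. char (distr \<Omega> borel Z) q = exp (of_real \<mu> * \<phi> (of_real q) * of_real (ln L)))"

definition extended_field ::
  "((real \<times> real) set \<Rightarrow> 'a \<Rightarrow> real) \<Rightarrow> ('a \<Rightarrow> real) \<Rightarrow> real \<Rightarrow> real \<Rightarrow> 'a \<Rightarrow> real" where
  "extended_field P Z \<epsilon> u x = id_field P \<epsilon> u x + Z x"

definition rho_eps :: "(real \<Rightarrow> real) \<Rightarrow> real \<Rightarrow> real \<Rightarrow> real" where
  "rho_eps r \<epsilon> u =
     (if \<bar>u\<bar> < \<epsilon> then - ln (r \<epsilon>) + (1 - \<bar>u\<bar> / \<epsilon>) * \<epsilon> * dlog r \<epsilon>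
      else if \<bar>u\<bar> \<le> 1 then - ln (r u) else 0)"

definition rho_L_eps :: "(real \<Rightarrow> real) \<Rightarrow> real \<Rightarrow> real \<Rightarrow> real \<Rightarrow> real" where
  "rho_L_eps r L \<epsilon> u = ln L + rho_eps r \<epsilon> u"

definition calB ::
  "(real \<Rightarrow> real \<Rightarrow> real) \<Rightarrow> (real \<Rightarrow> real \<Rightarrow> 'a \<Rightarrow> real) \<Rightarrow> real \<Rightarrow> real \<Rightarrow> 'a \<Rightarrow> real" where
  "calB f W \<delta> s x = exp (f \<delta> s + W \<delta> s x) - 1"

end

theory Submission
  imports Defs "HOL-Complex_Analysis.Cauchy_Integral_Formula"
begin

text \<open>
  Expanding the product over subsets, the expectation is an alternating sum of
  exp(delta * Lambda S) over S, where Lambda S collects the exponents of the independent atoms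
  of the cones A_1, ..., A_n. To first order in delta only the alternating sum of Lambda S
  matters, and there every atom that misses some A_j cancels. What is left is the mass
  of A_1 \<inter> A_n, computed by integrating by parts, times the n-th finite difference of the cumulant
  function.

  The exponential moments are recovered from the characteristic function alone: it extends
  analytically to the strip between 0 and -in, and shifting the contour in a Gaussian-smoothed
  Fourier inversion formula gives E exp(theta X - s^2 X^2 / 2), from which the limit of s to 0 is
  taken by monotone convergence.
\<close>

section \<open>Shifting a Gaussian contour\<close>

text \<open>The obstacle is that no exponential moment is part of the data: \<open>P\<close> and
  \<open>Z\<close> are described only by E exp(iqX) at real q, and the moment hypothesis concerns
  \<nu>. Integrability of exp(theta X) and its value must come out of one argument. The damping
  factor makes the integrand bounded, so Fubini applies before any moment is known to exist, and it
  weakens monotonically as s decreases. The depth n of the strip is forced by the product: an atom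
  lying in k of the chosen cones enters as exp(k X) with k \<le> n. The probability space may change
  with \<delta>, so nothing is compared pathwise. The exact formula exp(\<delta> * \<Lambda> S),
  with \<Lambda> free of \<delta>, carries the asymptotics, while the deterministic factors, which
  tend to 1 at no known rate, are kept unexpanded. The Gaussian part of the cumulant is quadratic,
  so its n-th difference survives only for n = 2; this is where the two cases of the theorem
  separate.\<close>

definition cnormal :: "real \<Rightarrow> complex \<Rightarrow> complex" where
  "cnormal s z = exp (- z\<^sup>2 / of_real (2 * s\<^sup>2)) / of_real (sqrt (2 * pi * s\<^sup>2))"

lemma cnormal_of_real: "cnormal s (of_real q) = of_real (normal_density 0 s q)"
  by (simp add: cnormal_def normal_density_def exp_of_real [symmetric])

text \<open>Off the real axis the Gaussian grows only by a factor depending on \<open>Im z\<close>,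
  so on a strip of bounded height it still decays uniformly in \<open>Re z\<close>.\<close>

lemma norm_cnormal:
  assumes "0 < s"
  shows "norm (cnormal s z) = exp ((Im z)\<^sup>2 / (2 * s\<^sup>2)) * normal_density 0 s (Re z)"
proof -
  have *: "Re (- z\<^sup>2 / of_real (2 * s\<^sup>2)) = (Im z)\<^sup>2 / (2 * s\<^sup>2) - (Re z)\<^sup>2 / (2 * s\<^sup>2)"
    by (simp only: Re_divide_of_real) (simp add: power2_eq_square diff_divide_distrib)
  show ?thesis
    unfolding cnormal_def norm_divide norm_exp_eq_Re norm_of_real * normal_density_def
    by (simp add: exp_diff exp_minus field_simps)
qed

text \<open>A function continuous on the closed strip and holomorphic inside has a primitive on the
  whole closed strip. Horizontal integrals are then increments of the primitive, and two of them
  differ by the increments along two vertical edges, which die with the Gaussian. Differentiability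
  of \<open>g\<close> on the real axis, where a characteristic function may fail to be analytic, is
  thus avoided.\<close>

lemma cnormal_shift:
  assumes s: "0 < s" and \<theta>: "0 \<le> \<theta>"
    and cont: "continuous_on {z. - \<theta> \<le> Im z \<and> Im z \<le> 0} g"
    and holo: "\<And>z. - \<theta> < Im z \<Longrightarrow> Im z < 0 \<Longrightarrow> g field_differentiable at z"
    and bound: "\<And>z. - \<theta> \<le> Im z \<Longrightarrow> Im z \<le> 0 \<Longrightarrow> norm (g z) \<le> C"
  shows "(LINT q|lborel. g (of_real q) * cnormal s (of_real q + \<i> * of_real \<theta>)) =
    (LINT q|lborel. g (of_real q - \<i> * of_real \<theta>) * of_real (normal_density 0 s q))"
proof -
  define S where "S = {z. - \<theta> \<le> Im z \<and> Im z \<le> 0}"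
  \<comment> \<open>The Gaussian is centred at -i theta: it is the real density on the lower edge of
    the strip and the shifted one on the real axis.\<close>
  define F where "F z = g z * cnormal s (z + \<i> * of_real \<theta>)" for z
  have C: "0 \<le> C" using order_trans[OF norm_ge_zero bound[of 0]] \<theta> by simp
  have S_eq: "S = {z. Im z \<ge> - \<theta>} \<inter> {z. Im z \<le> 0}" by (auto simp: S_def)
  have "convex S" unfolding S_eq by (intro convex_Int convex_halfspace_Im_ge convex_halfspace_Im_le)
  have intS: "interior S \<subseteq> {z. - \<theta> < Im z \<and> Im z < 0}"
    unfolding S_eq interior_Int
    using interior_halfspace_ge[of \<i> "- \<theta>"] interior_halfspace_le[of \<i> 0]
    by (auto simp: inner_complex_def)
  have gauss: "continuous_on UNIV (\<lambda>z. cnormal s (z + \<i> * of_real \<theta>))"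
    "(\<lambda>z. cnormal s (z + \<i> * of_real \<theta>)) field_differentiable at z" for z
    unfolding cnormal_def using s
    by (auto intro!: continuous_intros derivative_eq_intros simp: field_differentiable_def)
  have contF: "continuous_on S F"
    unfolding F_def S_def using cont continuous_on_subset[OF gauss(1)]
    by (intro continuous_on_mult) auto
  have holoF: "F field_differentiable at z" if "z \<in> interior S - {}" for z
    unfolding F_def using that intS holo gauss(2)
    by (intro field_differentiable_mult) auto
  obtain W where W: "\<And>z. z \<in> S \<Longrightarrow> (W has_field_derivative F z) (at z within S)"
    using holomorphic_convex_primitive[OF \<open>convex S\<close> finite.emptyI contF holoF] by blast
  \<comment> \<open>On the strip \<open>Im z + \<theta>\<close> lies between 0 and \<theta>, which
    bounds the growth factor of the Gaussian.\<close>
  define E where "E = C * exp (\<theta>\<^sup>2 / (2 * s\<^sup>2))"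
  have boundF: "norm (F z) \<le> E * normal_density 0 s (Re z)" if "z \<in> S" for z
  proof -
    have "(Im z + \<theta>)\<^sup>2 \<le> \<theta>\<^sup>2" using that by (intro power_mono) (auto simp: S_def)
    then have "norm (F z) \<le> C * (exp (\<theta>\<^sup>2 / (2 * s\<^sup>2)) * normal_density 0 s (Re z))"
      using that C s unfolding F_def norm_mult norm_cnormal[OF s]
      by (intro mult_mono bound) (auto simp: S_def divide_right_mono)
    then show ?thesis by (simp add: E_def mult_ac)
  qed
  \<comment> \<open>Increment of the primitive along the segment from -k to k at height
    -\<tau>.\<close>
  define I where "I \<tau> k = W (of_real (real k) - \<i> * of_real \<tau>) - W (- of_real (real k) - \<i> * of_real \<tau>)"
    for \<tau> k
  have lim: "I \<tau> \<longlonglongrightarrow> (LINT q|lborel. F (of_real q - \<i> * of_real \<tau>))" if \<tau>: "0 \<le> \<tau>" "\<tau> \<le> \<theta>" for \<tau>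
  proof -
    let ?p = "\<lambda>q. of_real q - \<i> * of_real \<tau> :: complex"
    have pS: "?p q \<in> S" for q using \<tau> by (auto simp: S_def)
    have contp: "continuous_on A (\<lambda>q. F (?p q))" for A
      by (rule continuous_on_compose2[OF contF]) (auto intro!: continuous_intros pS)
    have I_eq: "I \<tau> k = (LINT q|lborel. indicator {- real k..real k} q *\<^sub>R F (?p q))" for k
    proof -
      have "((\<lambda>q. W (?p q)) has_vector_derivative F (?p q)) (at q within {- real k..real k})" for q
      proof -
        have "(?p has_vector_derivative 1) (at q within {- real k..real k})"
          by (auto intro!: derivative_eq_intros)
        moreover have "(W has_field_derivative F (?p q)) (at (?p q) within ?p ` {- real k..real k})"
          using pS by (intro DERIV_subset[OF W[OF pS]]) auto
        ultimately show ?thesis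
          using field_vector_diff_chain_within[of ?p 1 q "{- real k..real k}" W "F (?p q)"] by (simp add: o_def)
      qed
      then show ?thesis
        by (subst integral_FTC_Icc[where F = "\<lambda>q. W (?p q)"]) (auto simp: I_def contp)
    qed
    show ?thesis unfolding I_eq
    proof (rule integral_dominated_convergence[where w = "\<lambda>q. E * normal_density 0 s q"])
      show "(\<lambda>q. F (?p q)) \<in> borel_measurable lborel"
        using borel_measurable_continuous_onI[OF contp] by simp
      then show "(\<lambda>q. indicator {- real k..real k} q *\<^sub>R F (?p q)) \<in> borel_measurable lborel" for k
        by measurable
      show "integrable lborel (\<lambda>q. E * normal_density 0 s q)" using s by simp
      show "AE q in lborel. (\<lambda>k. indicator {- real k..real k} q *\<^sub>R F (?p q)) \<longlonglongrightarrow> F (?p q)"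
      proof (rule AE_I2)
        fix q :: real
        have "eventually (\<lambda>k. indicator {- real k..real k} q *\<^sub>R F (?p q) = F (?p q)) sequentially"
        proof (rule eventually_sequentiallyI[of "nat \<lceil>\<bar>q\<bar>\<rceil>"])
          fix k assume "nat \<lceil>\<bar>q\<bar>\<rceil> \<le> k"
          then have "\<bar>q\<bar> \<le> real k" by linarith
          then show "indicator {- real k..real k} q *\<^sub>R F (?p q) = F (?p q)" by (auto simp: indicator_def abs_le_iff)
        qed
        then show "(\<lambda>k. indicator {- real k..real k} q *\<^sub>R F (?p q)) \<longlonglongrightarrow> F (?p q)" by (rule tendsto_eventually)
      qed
      show "AE q in lborel. norm (indicator {- real k..real k} q *\<^sub>R F (?p q)) \<le> E * normal_density 0 s q" for k
      proof (rule AE_I2)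
        fix q
        have "norm (F (?p q)) \<le> E * normal_density 0 s q" using boundF[OF pS, of q] by simp
        moreover have "0 \<le> E * normal_density 0 s q" using C by (simp add: E_def)
        ultimately show "norm (indicator {- real k..real k} q *\<^sub>R F (?p q)) \<le> E * normal_density 0 s q"
          by (auto simp: indicator_def)
      qed
    qed
  qed
  \<comment> \<open>An edge has length \<theta>, and on it the derivative \<open>F\<close> of
    \<open>W\<close> is at most a constant times the density at k; the mean value inequality does
    the rest.\<close>
  have edge: "(\<lambda>k. W (of_real (x k) - \<i> * of_real \<theta>) - W (of_real (x k))) \<longlonglongrightarrow> 0"
    if x: "\<And>k. x k = real k \<or> x k = - real k" for x :: "nat \<Rightarrow> real"
  proof (rule Lim_null_comparison)
    have nd: "(\<lambda>k. normal_density 0 s (real k)) \<longlonglongrightarrow> 0"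
      unfolding normal_density_def using s
      by real_asymp
    then show "(\<lambda>k. E * normal_density 0 s (real k) * \<theta>) \<longlonglongrightarrow> 0"
      by (auto intro!: tendsto_eq_intros)
    show "\<forall>\<^sub>F k in sequentially. norm (W (of_real (x k) - \<i> * of_real \<theta>) - W (of_real (x k)))
        \<le> E * normal_density 0 s (real k) * \<theta>"
    proof (intro always_eventually allI)
      fix k
      let ?T = "closed_segment (of_real (x k)) (of_real (x k) - \<i> * of_real \<theta>) :: complex set"
      have seg: "?T \<subseteq> S" using \<theta> by (intro closed_segment_subset \<open>convex S\<close>) (auto simp: S_def)
      have re: "Re z = x k" if "z \<in> ?T" for z
        using that by (auto simp: closed_segment_def complex_eq_iff algebra_simps)
      have "norm (W (of_real (x k) - \<i> * of_real \<theta>) - W (of_real (x k)))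
        \<le> E * normal_density 0 s (real k) * norm (of_real (x k) - \<i> * of_real \<theta> - of_real (x k))"
      proof (rule field_differentiable_bound[of ?T W F])
        fix z assume z: "z \<in> ?T"
        show "(W has_field_derivative F z) (at z within ?T)"
          using z seg by (intro DERIV_subset[OF W]) auto
        have "normal_density 0 s (x k) = normal_density 0 s (real k)"
          using x[of k] by (auto simp: normal_density_def)
        then show "norm (F z) \<le> E * normal_density 0 s (real k)"
          using boundF[of z] z seg re[OF z] by auto
      qed auto
      then show "norm (W (of_real (x k) - \<i> * of_real \<theta>) - W (of_real (x k)))
        \<le> E * normal_density 0 s (real k) * \<theta>" using \<theta> by (simp add: norm_mult)
    qed
  qed
  have "(\<lambda>k. I \<theta> k - I 0 k) \<longlonglongrightarrow> 0 - 0"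
    using tendsto_diff[OF edge[of real] edge[of "\<lambda>k. - real k"]]
    by (simp add: I_def algebra_simps)
  moreover have "(\<lambda>k. I \<theta> k - I 0 k) \<longlonglongrightarrow>
     (LINT q|lborel. F (of_real q - \<i> * of_real \<theta>)) - (LINT q|lborel. F (of_real q - \<i> * of_real 0))"
    using \<theta> by (intro tendsto_diff lim) auto
  ultimately have "(LINT q|lborel. F (of_real q - \<i> * of_real \<theta>)) = (LINT q|lborel. F (of_real q))"
    using LIMSEQ_unique by fastforce
  then show ?thesis by (simp add: F_def cnormal_of_real)
qed

section \<open>Exponential moments from the characteristic function\<close>

text \<open>Moves s from the Gaussian into the argument of the integrand, so that s can tend to 0
  under one fixed dominating density.\<close>

lemma integral_normal_density_scale:
  fixes h :: "real \<Rightarrow> complex"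
  assumes "0 < s"
  shows "(LINT q|lborel. h q * of_real (normal_density 0 s q)) =
    (LINT q|lborel. h (s * q) * of_real (std_normal_density q))"
proof -
  have "s * normal_density 0 s (s * q) = std_normal_density q" for q
    using assms by (simp add: normal_density_def real_sqrt_mult power_mult_distrib)
  then have "s *\<^sub>R (h (s * q) * of_real (normal_density 0 s (s * q))) = h (s * q) * of_real (std_normal_density q)" for q
    by (simp add: scaleR_conv_of_real mult.left_commute flip: of_real_mult)
  then show ?thesis
    using assms lborel_integral_real_affine[of s "\<lambda>q. h q * of_real (normal_density 0 s q)" 0]
    by (simp flip: integral_scaleR_right)
qed

lemma integral_iexp_normal_density:
  assumes "0 < s"
  shows "(LINT q|lborel. iexp (x * q) * of_real (normal_density 0 s q)) = of_real (exp (- (s * x)\<^sup>2 / 2))"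
proof -
  have "(LINT q|lborel. iexp (x * q) * of_real (normal_density 0 s q)) =
      (LINT q|lborel. iexp ((s * x) * q) * of_real (std_normal_density q))"
    using integral_normal_density_scale[OF assms, of "\<lambda>q. iexp (x * q)"] by (simp add: mult_ac)
  also have "\<dots> = char std_normal_distribution (s * x)"
    unfolding char_def
    by (subst integral_density) (auto simp: normal_density_nonneg scaleR_conv_of_real mult.commute)
  finally show ?thesis by (simp add: char_std_normal_distribution)
qed

text \<open>The damped exponential becomes a superposition of the oscillations exp(iqx) over real q,
  hence its expectation involves only the characteristic function. The contour shift is applied to
  exp(izx), which for fixed x is bounded on the strip.\<close>

lemma integral_iexp_cnormal:
  assumes s: "0 < s" and \<theta>: "0 \<le> \<theta>"
  shows "(LINT q|lborel. iexp (q * x) * cnormal s (of_real q + \<i> * of_real \<theta>)) =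
    of_real (exp (\<theta> * x - (s * x)\<^sup>2 / 2))"
proof -
  have bnd: "norm (exp (\<i> * z * of_real x)) \<le> exp (\<theta> * \<bar>x\<bar>)"
    if "- \<theta> \<le> Im z" "Im z \<le> 0" for z
  proof -
    have "- (Im z * x) \<le> \<bar>Im z\<bar> * \<bar>x\<bar>" by (metis abs_ge_minus_self abs_mult)
    also have "\<dots> \<le> \<theta> * \<bar>x\<bar>" using that by (intro mult_right_mono) auto
    finally show ?thesis by simp
  qed
  have "(LINT q|lborel. exp (\<i> * of_real q * of_real x) * cnormal s (of_real q + \<i> * of_real \<theta>)) =
    (LINT q|lborel. exp (\<i> * (of_real q - \<i> * of_real \<theta>) * of_real x) * of_real (normal_density 0 s q))"
    by (rule cnormal_shift[OF s \<theta>, where g = "\<lambda>z. exp (\<i> * z * of_real x)" and C = "exp (\<theta> * \<bar>x\<bar>)"])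
       (auto intro!: continuous_intros derivative_eq_intros bnd simp: field_differentiable_def simp del: norm_exp_eq_Re)
  also have "\<dots> = (LINT q|lborel. of_real (exp (\<theta> * x)) * (iexp (x * q) * of_real (normal_density 0 s q)))"
    by (rule Bochner_Integration.integral_cong)
       (simp_all add: exp_of_real[symmetric] exp_add[symmetric] ring_distribs mult_ac add_ac del: exp_of_real
         flip: mult.assoc[of "exp _"])
  also have "\<dots> = of_real (exp (\<theta> * x)) * of_real (exp (- (s * x)\<^sup>2 / 2))"
    by (simp only: integral_mult_right_zero integral_iexp_normal_density[OF s])
  also have "\<dots> = of_real (exp (\<theta> * x - (s * x)\<^sup>2 / 2))"
    by (simp flip: of_real_mult exp_add)
  finally show ?thesis by (simp add: mult_ac)
qed

text \<open>The contour is shifted twice, with Fubini in between: once for each value of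
  \<open>X\<close>, to express the damped exponential through real frequencies, and once for
  \<open>g\<close>, to pass from real frequencies to the line at height -\<theta>.\<close>

lemma exponential_moment_of_char_extension:
  assumes "prob_space M" and X[measurable]: "X \<in> borel_measurable M" and \<theta>: "0 \<le> \<theta>"
    and cont: "continuous_on {z. - \<theta> \<le> Im z \<and> Im z \<le> 0} g"
    and holo: "\<And>z. - \<theta> < Im z \<Longrightarrow> Im z < 0 \<Longrightarrow> g field_differentiable at z"
    and bound: "\<And>z. - \<theta> \<le> Im z \<Longrightarrow> Im z \<le> 0 \<Longrightarrow> norm (g z) \<le> C"
    and char: "\<And>q. char (distr M borel X) q = g (of_real q)"
  shows "integrable M (\<lambda>x. exp (\<theta> * X x))"
    and "of_real (LINT x|M. exp (\<theta> * X x)) = g (- \<i> * of_real \<theta>)"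
proof -
  interpret prob_space M by fact
  interpret pair_sigma_finite M lborel ..
  have smoothed: "of_real (LINT x|M. exp (\<theta> * X x - (s * X x)\<^sup>2 / 2)) =
      (LINT q|lborel. g (of_real (s * q) - \<i> * of_real \<theta>) * of_real (std_normal_density q))"
    if s: "0 < s" for s
  proof -
    let ?f = "\<lambda>x q. iexp (q * X x) * cnormal s (of_real q + \<i> * of_real \<theta>)"
    \<comment> \<open>On the line at height \<theta> the norm of the Gaussian is exactly
      \<open>K\<close> times a density, independently of x; this is what makes the product
      integrable.\<close>
    define K where "K = exp (\<theta>\<^sup>2 / (2 * s\<^sup>2))"
    have norm_f: "norm (?f x q) = K * normal_density 0 s q" for x q
      using norm_cnormal[OF s, of "of_real q + \<i> * of_real \<theta>"] by (simp add: norm_mult K_def)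
    have [measurable]: "(\<lambda>q. cnormal s (of_real q + \<i> * of_real \<theta>)) \<in> borel_measurable borel"
      unfolding cnormal_def by measurable
    have int_f: "integrable lborel (?f x)" for x
    proof (rule Bochner_Integration.integrable_bound[of _ "\<lambda>q. K * normal_density 0 s q"])
      show "AE q in lborel. norm (?f x q) \<le> norm (K * normal_density 0 s q)"
        unfolding norm_f by simp
    qed (use s in auto)
    have "integrable (M \<Otimes>\<^sub>M lborel) (case_prod ?f)"
    proof (rule Fubini_integrable)
      show "integrable M (\<lambda>x. LINT q|lborel. norm (case_prod ?f (x, q)))"
        unfolding prod.case norm_f by simp
    qed (use int_f in auto)
    then have "(LINT q|lborel. LINT x|M. ?f x q) = (LINT x|M. LINT q|lborel. ?f x q)"
      by (rule Fubini_integral)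
    also have "\<dots> = of_real (LINT x|M. exp (\<theta> * X x - (s * X x)\<^sup>2 / 2))"
      by (simp only: integral_iexp_cnormal[OF s \<theta>] integral_complex_of_real)
    finally have "of_real (LINT x|M. exp (\<theta> * X x - (s * X x)\<^sup>2 / 2)) = (LINT q|lborel. LINT x|M. ?f x q)" ..
    also have "\<dots> = (LINT q|lborel. g (of_real q) * cnormal s (of_real q + \<i> * of_real \<theta>))"
      by (simp add: char[symmetric] char_def integral_distr)
    also have "\<dots> = (LINT q|lborel. g (of_real q - \<i> * of_real \<theta>) * of_real (normal_density 0 s q))"
      by (rule cnormal_shift[OF s \<theta> cont holo bound])
    finally show ?thesis
      using integral_normal_density_scale[OF s, of "\<lambda>q. g (of_real q - \<i> * of_real \<theta>)"] by simp
  qed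
  let ?s = "\<lambda>m::nat. 1 / real (Suc m)"
  have s0: "?s \<longlonglongrightarrow> 0" by (rule LIMSEQ_Suc[OF lim_1_over_n])
  have contg: "continuous_on A (\<lambda>q. g (of_real (t * q) - \<i> * of_real \<theta>))" for A t
    by (rule continuous_on_compose2[OF cont]) (use \<theta> in \<open>auto intro!: continuous_intros\<close>)
  have gm: "(\<lambda>q. g (of_real (t * q) - \<i> * of_real \<theta>)) \<in> borel_measurable borel" for t
    by (rule borel_measurable_continuous_onI[OF contg])
  have "(\<lambda>m. LINT q|lborel. g (of_real (?s m * q) - \<i> * of_real \<theta>) * of_real (std_normal_density q)) \<longlonglongrightarrow>
      (LINT q|lborel. g (- \<i> * of_real \<theta>) * of_real (std_normal_density q))"
  proof (rule integral_dominated_convergence[where w = "\<lambda>q. C * std_normal_density q"])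
    show "integrable lborel (\<lambda>q. C * std_normal_density q)" by simp
    show "(\<lambda>q. g (of_real (?s m * q) - \<i> * of_real \<theta>) * of_real (std_normal_density q)) \<in> borel_measurable lborel" for m
      using gm[of "?s m"] by (intro borel_measurable_times) auto
    show "AE q in lborel. (\<lambda>m. g (of_real (?s m * q) - \<i> * of_real \<theta>) * of_real (std_normal_density q))
        \<longlonglongrightarrow> g (- \<i> * of_real \<theta>) * of_real (std_normal_density q)"
    proof (rule AE_I2)
      fix q
      have "(\<lambda>m. of_real (?s m * q) - \<i> * of_real \<theta>) \<longlonglongrightarrow> of_real (0 * q) - \<i> * of_real \<theta>"
        by (intro tendsto_intros s0)
      then have "(\<lambda>m. g (of_real (?s m * q) - \<i> * of_real \<theta>)) \<longlonglongrightarrow> g (- \<i> * of_real \<theta>)"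
        using \<theta> by (intro continuous_on_tendsto_compose[OF cont]) auto
      then show "(\<lambda>m. g (of_real (?s m * q) - \<i> * of_real \<theta>) * of_real (std_normal_density q))
        \<longlonglongrightarrow> g (- \<i> * of_real \<theta>) * of_real (std_normal_density q)" by (intro tendsto_intros)
    qed
    show "AE q in lborel. norm (g (of_real (?s m * q) - \<i> * of_real \<theta>) * of_real (std_normal_density q))
        \<le> C * std_normal_density q" for m
      using \<theta> by (auto simp: norm_mult intro!: mult_right_mono bound)
  qed auto
  also have "(LINT q|lborel. g (- \<i> * of_real \<theta>) * of_real (std_normal_density q)) = g (- \<i> * of_real \<theta>)"
    using integral_iexp_normal_density[of 1 0] by simp
  finally have lim: "(\<lambda>m. of_real (LINT x|M. exp (\<theta> * X x - (?s m * X x)\<^sup>2 / 2))) \<longlonglongrightarrow> g (- \<i> * of_real \<theta>)"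
    by (simp only: smoothed zero_less_divide_1_iff of_nat_0_less_iff zero_less_Suc)
  \<comment> \<open>Completing the square bounds the damped exponential, so it is integrable on a
    probability space for every t > 0.\<close>
  have bnd: "exp (\<theta> * x - (t * x)\<^sup>2 / 2) \<le> exp (\<theta>\<^sup>2 / (2 * t\<^sup>2))" if "t > 0" for x t :: real
  proof -
    have "0 \<le> (t * x - \<theta> / t)\<^sup>2 / 2" by simp
    also have "\<dots> = (t * x)\<^sup>2 / 2 - \<theta> * x + \<theta>\<^sup>2 / (2 * t\<^sup>2)"
      using that by (simp add: power2_diff power_divide add_divide_distrib diff_divide_distrib)
    finally show ?thesis by simp
  qed
  let ?h = "\<lambda>m x. exp (\<theta> * X x - (?s m * X x)\<^sup>2 / 2)"
  have conv: "(\<lambda>m. LINT x|M. ?h m x) \<longlonglongrightarrow> Re (g (- \<i> * of_real \<theta>))"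
    using tendsto_Re[OF lim] by simp
  have inth: "integrable M (?h m)" for m
    by (rule integrable_const_bound[of _ "exp (\<theta>\<^sup>2 / (2 * (?s m)\<^sup>2))"]) (use bnd[of "?s m"] in auto)
  have mono: "mono (\<lambda>m. ?h m x)" for x
  proof (rule monoI)
    fix i j :: nat assume "i \<le> j"
    then have "?s j \<le> ?s i" by (simp add: field_simps)
    then have "(?s j)\<^sup>2 * (X x)\<^sup>2 \<le> (?s i)\<^sup>2 * (X x)\<^sup>2" by (intro mult_right_mono power_mono) auto
    then show "?h i x \<le> ?h j x" by (simp add: power_mult_distrib power_divide)
  qed
  have point: "(\<lambda>m. ?h m x) \<longlonglongrightarrow> exp (\<theta> * X x)" for x
  proof -
    have "(\<lambda>m. ?h m x) \<longlonglongrightarrow> exp (\<theta> * X x - (0 * X x)\<^sup>2 / 2)" by (intro tendsto_intros s0) auto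
    then show ?thesis by simp
  qed
  show int: "integrable M (\<lambda>x. exp (\<theta> * X x))"
    by (rule integrable_monotone_convergence[OF inth _ _ conv]) (use mono point in auto)
  have "(LINT x|M. exp (\<theta> * X x)) = Re (g (- \<i> * of_real \<theta>))"
    by (rule integral_monotone_convergence[OF inth _ _ conv]) (use mono point in auto)
  \<comment> \<open>The approximating expectations are real, hence so is their limit.\<close>
  moreover have "Im (g (- \<i> * of_real \<theta>)) = 0"
    using tendsto_Im[OF lim] LIMSEQ_unique[of "\<lambda>m. 0::real" 0] by (simp add: LIMSEQ_const_iff)
  ultimately show "of_real (LINT x|M. exp (\<theta> * X x)) = g (- \<i> * of_real \<theta>)"
    by (simp add: complex_eq_iff)
qed

section \<open>Holomorphy of the Levy exponent\<close>

lemma field_differentiable_integral: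
  fixes K :: "complex \<Rightarrow> 'b \<Rightarrow> complex"
  assumes d: "0 < d"
    and meas: "\<And>y. y \<in> ball z d \<Longrightarrow> K y \<in> borel_measurable M"
    and holo: "\<And>u. u \<in> space M \<Longrightarrow> (\<lambda>y. K y u) holomorphic_on ball z d"
    and bound: "\<And>y u. y \<in> ball z d \<Longrightarrow> u \<in> space M \<Longrightarrow> norm (K y u) \<le> w u"
    and w: "integrable M w"
  shows "(\<lambda>y. LINT u|M. K y u) field_differentiable at z"
proof -
  define K' where "K' u = deriv (\<lambda>y. K y u) z" for u
  have int: "integrable M (K y)" if "y \<in> ball z d" for y
    by (rule Bochner_Integration.integrable_bound[OF w meas[OF that]])
       (auto intro!: AE_I2 order_trans[OF bound[OF that]])
  txt \<open>Cauchy's estimate bounds the derivative of the integrand by a multiple of w, so that no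
    separate domination of the derivative is needed.\<close>
  have quot_bound: "norm ((K (z + h) u - K z u) / h) \<le> 3 / d * w u"
    if h: "norm h < d / 3" "h \<noteq> 0" and u: "u \<in> space M" for h u
  proof -
    let ?f = "\<lambda>y. K y u"
    have der: "norm (deriv ?f y) \<le> 3 / d * w u" if y: "y \<in> ball z (d / 3)" for y
    proof -
      \<comment> \<open>The radius d/3 is used twice: the segment from z to z + h stays within d/3
        of z, and the Cauchy circle about any point of it still stays inside the ball of radius
        d.\<close>
      have sub: "cball y (d / 3) \<subseteq> ball z d"
      proof
        fix x assume "x \<in> cball y (d / 3)"
        then show "x \<in> ball z d" using y dist_triangle[of z x y] d by (auto simp: dist_commute)
      qed
      have "norm ((deriv ^^ 1) ?f y) \<le> fact 1 * w u / (d / 3) ^ 1"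
      proof (rule Cauchy_inequality)
        show "?f holomorphic_on ball y (d / 3)"
          by (rule holomorphic_on_subset[OF holo[OF u]]) (use sub ball_subset_cball in blast)
        show "continuous_on (cball y (d / 3)) ?f"
          by (rule continuous_on_subset[OF holomorphic_on_imp_continuous_on[OF holo[OF u]] sub])
        show "norm (K x u) \<le> w u" if "norm (y - x) = d / 3" for x
          using that sub u by (intro bound) (auto simp: dist_norm)
      qed (use d in auto)
      then show ?thesis by (simp add: mult_ac)
    qed
    have "norm (K (z + h) u - K z u) \<le> 3 / d * w u * norm (z + h - z)"
    proof (rule field_differentiable_bound[of "ball z (d / 3)"])
      fix y assume y: "y \<in> ball z (d / 3)"
      have "y \<in> ball z d" using y d by auto
      then show "(?f has_field_derivative deriv ?f y) (at y within ball z (d / 3))"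
        using holomorphic_derivI[OF holo[OF u]] by (blast intro: has_field_derivative_at_within open_ball)
    qed (use h d der in \<open>auto simp: dist_norm\<close>)
    then show ?thesis using h by (simp add: norm_divide divide_le_eq)
  qed
  have point: "((\<lambda>h. (K (z + h) u - K z u) / h) \<longlongrightarrow> K' u) (at 0)" if "u \<in> space M" for u
    using holomorphic_derivI[OF holo[OF that] open_ball, of z UNIV] d by (simp add: K'_def DERIV_def)
  have quot_meas: "(\<lambda>u. (K (z + h) u - K z u) / h) \<in> borel_measurable M" if "norm h < d" for h
    using meas[of "z + h"] meas[of z] that d by (auto simp: dist_norm)
  \<comment> \<open>Measurability of the derivative is inherited from difference quotients along one
    fixed null sequence inside the ball.\<close>
  have meas': "K' \<in> borel_measurable M"
  proof (rule borel_measurable_LIMSEQ_metric)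
    let ?h = "\<lambda>k::nat. of_real (d * (1 / 2) ^ Suc k) :: complex"
    have small: "norm (?h k) < d" for k
      unfolding norm_of_real using d power_Suc_less_one[of "1/2::real" k]
      by (simp only: abs_mult abs_of_pos abs_of_nonneg zero_le_power) (simp add: field_simps)
    then show "(\<lambda>u. (K (z + ?h k) u - K z u) / ?h k) \<in> borel_measurable M" for k
      by (rule quot_meas)
    have "(\<lambda>k. d * (1 / 2) ^ Suc k) \<longlonglongrightarrow> d * 0"
      by (intro tendsto_intros LIMSEQ_Suc LIMSEQ_power_zero) simp
    from tendsto_of_real[OF this] have "?h \<longlonglongrightarrow> 0" by (simp only: mult_zero_right of_real_0)
    then have "filterlim ?h (at 0) sequentially"
      using d by (simp add: filterlim_at)
    then show "(\<lambda>k. (K (z + ?h k) u - K z u) / ?h k) \<longlonglongrightarrow> K' u" if "u \<in> space M" for u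
      by (rule filterlim_compose[OF point[OF that]])
  qed
  have "((\<lambda>h. ((LINT u|M. K (z + h) u) - (LINT u|M. K z u)) / h) \<longlongrightarrow> (LINT u|M. K' u)) (at 0)"
    unfolding tendsto_at_iff_sequentially o_def
  proof (intro allI impI)
    fix X :: "nat \<Rightarrow> complex" assume X: "\<forall>i. X i \<in> UNIV - {0}" "X \<longlonglongrightarrow> 0"
    have ev: "\<forall>\<^sub>F k in sequentially. norm (X k) < d / 3"
      using order_tendstoD(2)[OF tendsto_norm_zero[OF X(2)], of "d / 3"] d by simp
    then obtain k0 where k0: "\<And>k. k0 \<le> k \<Longrightarrow> norm (X k) < d / 3"
      unfolding eventually_sequentially by blast
    \<comment> \<open>Dropping the first k0 terms makes the quotient bound hold at every index;
      \<open>LIMSEQ_offset\<close> restores them at the end.\<close>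
    define Y where "Y k = X (k + k0)" for k
    have Y: "norm (Y k) < d / 3" "Y k \<noteq> 0" for k using k0 X(1) by (auto simp: Y_def)
    have Ylim: "filterlim Y (at 0) sequentially"
      using LIMSEQ_ignore_initial_segment[OF X(2), of k0] Y(2) by (simp add: filterlim_at Y_def[abs_def])
    have "(\<lambda>k. LINT u|M. (K (z + Y k) u - K z u) / Y k) \<longlonglongrightarrow> (LINT u|M. K' u)"
    proof (rule integral_dominated_convergence[where w = "\<lambda>u. 3 / d * w u"])
      show "AE u in M. (\<lambda>k. (K (z + Y k) u - K z u) / Y k) \<longlonglongrightarrow> K' u"
        using filterlim_compose[OF point Ylim] by auto
      show "(\<lambda>u. (K (z + Y k) u - K z u) / Y k) \<in> borel_measurable M" for k
        using Y(1)[of k] d by (intro quot_meas) auto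
      show "AE u in M. norm ((K (z + Y k) u - K z u) / Y k) \<le> 3 / d * w u" for k
        using quot_bound[OF Y] by auto
    qed (use w meas' in auto)
    moreover have "(LINT u|M. (K (z + Y k) u - K z u) / Y k) =
        ((LINT u|M. K (z + Y k) u) - (LINT u|M. K z u)) / Y k" for k
    proof -
      have "z \<in> ball z d" "z + Y k \<in> ball z d" using Y(1)[of k] d by (auto simp: dist_norm)
      then show ?thesis using int by (simp add: Bochner_Integration.integral_diff)
    qed
    ultimately have "(\<lambda>k. ((LINT u|M. K (z + X (k + k0)) u) - (LINT u|M. K z u)) / X (k + k0))
        \<longlonglongrightarrow> (LINT u|M. K' u)" by (simp only: Y_def)
    then show "(\<lambda>k. ((LINT u|M. K (z + X k) u) - (LINT u|M. K z u)) / X k) \<longlonglongrightarrow> (LINT u|M. K' u)"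
      by (rule LIMSEQ_offset)
  qed
  then show ?thesis unfolding field_differentiable_def DERIV_def by blast
qed

section \<open>Domination and values of the Levy exponent on the strip\<close>

definition levy_kernel :: "complex \<Rightarrow> real \<Rightarrow> complex" where
  "levy_kernel z u = exp (\<i> * z * of_real u) - 1 - \<i> * z * (of_real (exp u) - 1)"

text \<open>A majorant, up to constants, of the kernel on -T \<le> Im z \<le> 0: the kernel has a
  double zero at u = 0, grows at most like exp(T u) for large positive u, and stays bounded for u <
  -1 because exp(izu) has norm at most 1 there.\<close>

definition levy_weight :: "real \<Rightarrow> real \<Rightarrow> real" where
  "levy_weight T u = (if \<bar>u\<bar> \<le> 1 then u\<^sup>2 else if 1 < u then exp (T * u) else 1)"

lemma norm_exp_minus_linear: "norm (exp w - (1 + w :: complex)) \<le> exp \<bar>Re w\<bar> * (norm w)\<^sup>2"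
proof -
  have "(\<Sum>k\<le>1. w ^ k / fact k) = 1 + w" by simp
  then show ?thesis
    using Taylor_exp[of w 1]
    by (simp only: power2_eq_square power_Suc power_0 One_nat_def fact_1 fact_Suc_0 div_by_1)
qed

text \<open>The constant simply adds up what the three ranges of u require; the condition 1 \<le> T
  lets exp(T u) absorb the compensator exp(u) on the range u > 1.\<close>

lemma levy_kernel_bound:
  assumes T: "1 \<le> T" and z: "- T \<le> Im z" "Im z \<le> 0" "norm z \<le> R"
  shows "norm (levy_kernel z u) \<le> (exp R * R\<^sup>2 + 3 * R + 2) * levy_weight T u"
proof -
  have triangle: "norm (a - 1 - b) \<le> norm a + 1 + norm b" for a b :: complex
    using norm_triangle_ineq4[of "a - 1" b] norm_triangle_ineq4[of a 1] by simp
  have norm_lin: "norm (\<i> * z * (of_real (exp u) - 1)) = norm z * \<bar>exp u - 1\<bar>"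
  proof -
    have "of_real (exp u) - 1 = (of_real (exp u - 1) :: complex)" by simp
    then show ?thesis by (simp only: norm_mult norm_of_real norm_ii mult_1_left)
  qed
  have R: "0 \<le> R" using z(3) norm_ge_zero order_trans by blast
  consider "\<bar>u\<bar> \<le> 1" | "1 < u" | "u < - 1" by linarith
  then show ?thesis
  proof cases
    case 1
    have 2: "norm (\<i> * z * of_real u) \<le> R * \<bar>u\<bar>"
      using z(3) by (simp add: norm_mult mult_right_mono)
    have 3: "R * \<bar>u\<bar> \<le> R" using 1 R by (simp add: mult_left_le)
    have "norm (exp (\<i> * z * of_real u) - (1 + \<i> * z * of_real u)) \<le>
        exp \<bar>Re (\<i> * z * of_real u)\<bar> * norm (\<i> * z * of_real u) ^ 2"
      by (rule norm_exp_minus_linear)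
    also have "\<dots> \<le> exp R * (R * \<bar>u\<bar>) ^ 2"
      using order_trans[OF abs_Re_le_cmod order_trans[OF 2 3]]
      by (intro mult_mono power_mono 2) (simp_all only: exp_le_cancel_iff norm_ge_zero exp_ge_zero zero_le_power2)
    finally have a: "norm (exp (\<i> * z * of_real u) - (1 + \<i> * z * of_real u)) \<le> exp R * R\<^sup>2 * u\<^sup>2"
      by (simp add: power_mult_distrib)
    have "norm (exp (of_real u) - (1 + of_real u :: complex)) \<le> exp \<bar>u\<bar> * \<bar>u\<bar> ^ 2"
      using norm_exp_minus_linear[of "of_real u"] by simp
    also have "\<dots> \<le> 3 * u\<^sup>2"
      using 1 exp_le order_trans[OF exp_le_cancel_iff[THEN iffD2], of "\<bar>u\<bar>" 1 3] by (simp add: mult_right_mono)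
    finally have b: "norm (exp (of_real u) - (1 + of_real u :: complex)) \<le> 3 * u\<^sup>2" .
    \<comment> \<open>Adding and subtracting izu cancels the linear terms and leaves two
      second-order Taylor remainders, one at izu and one at u.\<close>
    have eq: "levy_kernel z u = (exp (\<i> * z * of_real u) - (1 + \<i> * z * of_real u))
        - \<i> * z * (exp (of_real u) - (1 + of_real u))"
      by (simp add: levy_kernel_def algebra_simps exp_of_real)
    have "norm (levy_kernel z u) \<le> exp R * R\<^sup>2 * u\<^sup>2 + norm (\<i> * z * (exp (of_real u) - (1 + of_real u)))"
      unfolding eq by (rule order_trans[OF norm_triangle_ineq4 add_right_mono[OF a]])
    also have "norm (\<i> * z * (exp (of_real u) - (1 + of_real u))) \<le> R * (3 * u\<^sup>2)"
      using mult_mono[OF z(3) b] R by (simp add: norm_mult)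
    finally have "norm (levy_kernel z u) \<le> (exp R * R\<^sup>2 + 3 * R + 2) * u\<^sup>2"
      unfolding distrib_right using zero_le_power2[of u] by linarith
    then show ?thesis using 1 by (simp add: levy_weight_def)
  next
    case 2
    have "- Im z * u \<le> T * u" using z 2 by (intro mult_right_mono) auto
    then have a: "norm (exp (\<i> * z * of_real u)) \<le> exp (T * u)" by simp
    have "1 * u \<le> T * u" using T 2 by (intro mult_right_mono) auto
    then have b: "exp u \<le> exp (T * u)" "1 \<le> exp u" using 2 by auto
    have "norm (levy_kernel z u) \<le> norm (exp (\<i> * z * of_real u)) + 1 + norm (\<i> * z * (of_real (exp u) - 1))"
      unfolding levy_kernel_def by (rule triangle)
    also have "norm (\<i> * z * (of_real (exp u) - 1)) = norm z * \<bar>exp u - 1\<bar>"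
      by (rule norm_lin)
    also have "\<dots> \<le> R * exp (T * u)"
    proof (rule mult_mono[OF z(3)])
      show "\<bar>exp u - 1\<bar> \<le> exp (T * u)" using b by linarith
    qed (use R in auto)
    finally have "norm (levy_kernel z u) \<le> (2 + R) * exp (T * u)"
      using a b unfolding distrib_right by linarith
    also have "\<dots> \<le> (exp R * R\<^sup>2 + 3 * R + 2) * exp (T * u)"
      using R by (intro mult_right_mono) auto
    finally show ?thesis using 2 by (simp add: levy_weight_def)
  next
    case 3
    have "- (Im z * u) \<le> 0" using z 3 by (simp add: mult_nonpos_nonpos)
    then have a: "norm (exp (\<i> * z * of_real u)) \<le> 1" by simp
    have "norm (levy_kernel z u) \<le> norm (exp (\<i> * z * of_real u)) + 1 + norm (\<i> * z * (of_real (exp u) - 1))"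
      unfolding levy_kernel_def by (rule triangle)
    also have "norm (\<i> * z * (of_real (exp u) - 1)) = norm z * \<bar>exp u - 1\<bar>"
      by (rule norm_lin)
    also have "\<dots> \<le> R * 1"
      using z(3) R 3 by (intro mult_mono) (auto simp: abs_if)
    finally have "norm (levy_kernel z u) \<le> 2 + R" using a by linarith
    also have "\<dots> \<le> exp R * R\<^sup>2 + 3 * R + 2" using R by auto
    finally show ?thesis using 3 by (simp add: levy_weight_def)
  qed
qed

text \<open>The exponent at -i \<theta>, that is, the logarithm of the exponential moment per unit
  of mass; the drift normalisation makes it vanish at \<theta> = 1 as well as at 0.\<close>

definition levy_cumulant :: "real \<Rightarrow> real measure \<Rightarrow> real \<Rightarrow> real" where
  "levy_cumulant \<sigma> \<nu> \<theta> =
     \<sigma>\<^sup>2 * (\<theta>\<^sup>2 - \<theta>) / 2 + (LINT u|\<nu>. (exp (\<theta> * u) - 1 - \<theta> * (exp u - 1)))"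

text \<open>Common ground of the Stieltjes and the point mass case. \<open>T\<close> is the depth of
  the strip on which the exponent is defined, later the number of factors n.\<close>

locale levy_moment_measure =
  fixes \<nu> :: "real measure" and T :: real
  assumes sets_eq: "sets \<nu> = sets (restrict_space borel (- {0}))"
    and weight: "integrable \<nu> (levy_weight T)"
    and T: "1 \<le> T"
begin

lemma borel_measurableI: "f \<in> borel_measurable borel \<Longrightarrow> f \<in> borel_measurable \<nu>"
  unfolding measurable_cong_sets[OF sets_eq refl] by (rule measurable_restrict_space1)

lemma levy_kernel_measurable: "levy_kernel z \<in> borel_measurable \<nu>"
  unfolding levy_kernel_def[abs_def] by (rule borel_measurableI) measurable

lemma integrable_levy_kernel:
  assumes "- T \<le> Im z" "Im z \<le> 0"
  shows "integrable \<nu> (levy_kernel z)"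
proof (rule Bochner_Integration.integrable_bound[OF _ levy_kernel_measurable])
  let ?R = "norm z"
  show "integrable \<nu> (\<lambda>u. (exp ?R * ?R\<^sup>2 + 3 * ?R + 2) * levy_weight T u)" using weight by simp
  show "AE u in \<nu>. norm (levy_kernel z u) \<le> norm ((exp ?R * ?R\<^sup>2 + 3 * ?R + 2) * levy_weight T u)"
    using levy_kernel_bound[OF T assms order_refl] by (auto intro!: AE_I2 order_trans[OF _ abs_ge_self])
qed

lemma levy_exponent_eq:
  "levy_exponent \<sigma> \<nu> q =
     - (\<i> * q * of_real (\<sigma>\<^sup>2)) / 2 - q\<^sup>2 * of_real (\<sigma>\<^sup>2) / 2 + (LINT u|\<nu>. levy_kernel q u)"
  by (simp add: levy_exponent_def levy_kernel_def)

lemma continuous_on_levy_exponent: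
  "continuous_on {z. - T \<le> Im z \<and> Im z \<le> 0} (levy_exponent \<sigma> \<nu>)"
proof -
  have "continuous_on {z. - T \<le> Im z \<and> Im z \<le> 0} (\<lambda>z. LINT u|\<nu>. levy_kernel z u)"
    unfolding continuous_on_sequentially o_def
  proof (intro allI ballI impI)
    fix x a assume "a \<in> {z. - T \<le> Im z \<and> Im z \<le> 0}"
      and x: "(\<forall>k. x k \<in> {z. - T \<le> Im z \<and> Im z \<le> 0}) \<and> x \<longlonglongrightarrow> a"
    then have "Bseq x" by (auto intro: convergent_imp_Bseq convergentI)
    \<comment> \<open>The majorant depends on the norm of z, so domination is available only along
      bounded sequences.\<close>
    then obtain R where R: "\<And>k. norm (x k) \<le> R" by (auto simp: Bseq_def)
    show "(\<lambda>k. LINT u|\<nu>. levy_kernel (x k) u) \<longlonglongrightarrow> (LINT u|\<nu>. levy_kernel a u)"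
    proof (rule integral_dominated_convergence[where w = "\<lambda>u. (exp R * R\<^sup>2 + 3 * R + 2) * levy_weight T u"])
      show "AE u in \<nu>. (\<lambda>k. levy_kernel (x k) u) \<longlonglongrightarrow> levy_kernel a u"
        unfolding levy_kernel_def using x by (auto intro!: tendsto_intros)
      show "AE u in \<nu>. norm (levy_kernel (x k) u) \<le> (exp R * R\<^sup>2 + 3 * R + 2) * levy_weight T u" for k
        using x R by (intro AE_I2 levy_kernel_bound T) auto
    qed (use weight levy_kernel_measurable in auto)
  qed
  then show ?thesis unfolding levy_exponent_eq[abs_def] by (intro continuous_intros) auto
qed

lemma levy_exponent_field_differentiable:
  assumes "- T < Im z" "Im z < 0"
  shows "levy_exponent \<sigma> \<nu> field_differentiable at z"
proof -
  \<comment> \<open>Distance from z to the nearer edge of the strip, so that the whole ball lies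
    where the weight dominates.\<close>
  define d where "d = min (Im z + T) (- Im z)"
  have d: "0 < d" using assms by (simp add: d_def)
  have ball: "- T \<le> Im y" "Im y \<le> 0" "norm y \<le> norm z + d" if "y \<in> ball z d" for y
  proof -
    have "norm (y - z) < d" using that by (simp add: dist_norm norm_minus_commute)
    then show "- T \<le> Im y" "Im y \<le> 0" "norm y \<le> norm z + d"
      using abs_Im_le_cmod[of "y - z"] norm_triangle_ineq[of z "y - z"] by (auto simp: d_def)
  qed
  have "(\<lambda>z. LINT u|\<nu>. levy_kernel z u) field_differentiable at z"
  proof (rule field_differentiable_integral[OF d])
    let ?R = "norm z + d"
    show "norm (levy_kernel y u) \<le> (exp ?R * ?R\<^sup>2 + 3 * ?R + 2) * levy_weight T u" if "y \<in> ball z d" for y u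
      by (rule levy_kernel_bound[OF T ball[OF that]])
    show "(\<lambda>y. levy_kernel y u) holomorphic_on ball z d" for u
      unfolding levy_kernel_def by (intro holomorphic_intros)
  qed (use weight levy_kernel_measurable in auto)
  moreover have "(\<lambda>q. - (\<i> * q * of_real (\<sigma>\<^sup>2)) / 2 - q\<^sup>2 * of_real (\<sigma>\<^sup>2) / 2) field_differentiable at z"
    by (auto intro!: derivative_eq_intros simp: field_differentiable_def)
  ultimately show ?thesis
    unfolding levy_exponent_eq[abs_def] by (intro field_differentiable_add) auto
qed

text \<open>The counterpart of |E exp(izX)| \<le> E exp(-(Im z) X): the compensator contributes a
  real part depending on \<open>Im z\<close> alone, exp(izu) has real part at most its norm, and the
  Gaussian term loses a square. An unbounded strip is thereby controlled by a compact imaginary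
  segment.\<close>

lemma Re_levy_exponent_le:
  assumes "- T \<le> Im z" "Im z \<le> 0"
  shows "Re (levy_exponent \<sigma> \<nu> z) \<le> Re (levy_exponent \<sigma> \<nu> (\<i> * of_real (Im z)))"
proof -
  have "Re (LINT u|\<nu>. levy_kernel z u) \<le> Re (LINT u|\<nu>. levy_kernel (\<i> * of_real (Im z)) u)"
  proof -
    have i1: "integrable \<nu> (levy_kernel z)" "integrable \<nu> (levy_kernel (\<i> * of_real (Im z)))"
      using assms by (auto intro!: integrable_levy_kernel)
    have "Re (levy_kernel z u) \<le> Re (levy_kernel (\<i> * of_real (Im z)) u)" for u
      by (simp add: levy_kernel_def Re_exp mult_left_le)
    then show ?thesis
      unfolding integral_Re[OF i1(1), symmetric] integral_Re[OF i1(2), symmetric]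
      using i1 by (intro integral_mono integrable_Re) auto
  qed
  moreover have "- ((Re z)\<^sup>2 * \<sigma>\<^sup>2) \<le> 0" by simp
  ultimately show ?thesis
    unfolding levy_exponent_eq
    by (simp add: power2_eq_square[of z] power2_eq_square[of "\<i> * _"] power2_eq_square[of "Re z"]
        power2_eq_square[of "Im z"] algebra_simps diff_divide_distrib add_divide_distrib)
qed

lemma levy_exponent_imaginary:
  assumes "0 \<le> \<theta>" "\<theta> \<le> T"
  shows "levy_exponent \<sigma> \<nu> (- \<i> * of_real \<theta>) = of_real (levy_cumulant \<sigma> \<nu> \<theta>)"
proof -
  have "(LINT u|\<nu>. levy_kernel (- \<i> * of_real \<theta>) u) =
      (LINT u|\<nu>. of_real (exp (\<theta> * u) - 1 - \<theta> * (exp u - 1)))"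
    by (simp add: levy_kernel_def exp_of_real[symmetric] del: exp_of_real)
  also have "\<dots> = of_real (LINT u|\<nu>. (exp (\<theta> * u) - 1 - \<theta> * (exp u - 1)))"
    by (rule integral_complex_of_real)
  finally show ?thesis
    unfolding levy_exponent_eq levy_cumulant_def
    by (simp add: power_mult_distrib field_simps)
qed

lemma integrable_levy_cumulant_kernel:
  assumes "0 \<le> \<theta>" "\<theta> \<le> T"
  shows "integrable \<nu> (\<lambda>u. exp (\<theta> * u) - 1 - \<theta> * (exp u - 1))"
proof -
  have "integrable \<nu> (\<lambda>u. Re (levy_kernel (- \<i> * of_real \<theta>) u))"
    using assms by (intro integrable_Re integrable_levy_kernel) auto
  moreover have "Re (levy_kernel (- \<i> * of_real \<theta>) u) = exp (\<theta> * u) - 1 - \<theta> * (exp u - 1)" for u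
    by (simp add: levy_kernel_def Re_exp)
  ultimately show ?thesis by simp
qed

lemma exponential_moment:
  assumes "prob_space M" and X: "X \<in> borel_measurable M" and c: "0 \<le> c"
    and char: "\<And>q. char (distr M borel X) q = exp (of_real c * levy_exponent \<sigma> \<nu> (of_real q))"
    and \<theta>: "0 \<le> \<theta>" "\<theta> \<le> T"
  shows "integrable M (\<lambda>x. exp (\<theta> * X x))"
    and "(LINT x|M. exp (\<theta> * X x)) = exp (c * levy_cumulant \<sigma> \<nu> \<theta>)"
proof -
  define g where "g z = exp (of_real c * levy_exponent \<sigma> \<nu> z)" for z
  have "continuous_on {- T..0} (\<lambda>t. Re (levy_exponent \<sigma> \<nu> (\<i> * of_real t)))"
    by (intro continuous_intros continuous_on_compose2[OF continuous_on_levy_exponent]) auto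
  then have "compact ((\<lambda>t. Re (levy_exponent \<sigma> \<nu> (\<i> * of_real t))) ` {- T..0})"
    by (intro compact_continuous_image) auto
  then obtain B where B: "\<And>t. t \<in> {- T..0} \<Longrightarrow> Re (levy_exponent \<sigma> \<nu> (\<i> * of_real t)) \<le> B"
    using compact_imp_bounded bounded_imp_bdd_above unfolding bdd_above_def by (metis imageI)
  have bound: "norm (g z) \<le> exp (c * B)" if "- \<theta> \<le> Im z" "Im z \<le> 0" for z
  proof -
    have "Re (levy_exponent \<sigma> \<nu> z) \<le> B"
      using that \<theta> by (intro order_trans[OF Re_levy_exponent_le B]) auto
    then show ?thesis using c by (simp add: g_def mult_left_mono)
  qed
  have cont: "continuous_on {z. - \<theta> \<le> Im z \<and> Im z \<le> 0} g"
    unfolding g_def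
    by (intro continuous_intros continuous_on_subset[OF continuous_on_levy_exponent]) (use \<theta> in auto)
  have holo: "g field_differentiable at z" if "- \<theta> < Im z" "Im z < 0" for z
  proof -
    have "levy_exponent \<sigma> \<nu> field_differentiable at z"
      using that \<theta> by (intro levy_exponent_field_differentiable) auto
    then show ?thesis
      unfolding g_def field_differentiable_def by (auto intro!: derivative_eq_intros)
  qed
  have char': "char (distr M borel X) q = g (of_real q)" for q by (simp add: char g_def)
  note * = exponential_moment_of_char_extension[OF assms(1) X \<theta>(1) cont holo bound char']
  show "integrable M (\<lambda>x. exp (\<theta> * X x))" by (rule *(1))
  have "of_real (LINT x|M. exp (\<theta> * X x)) = g (- \<i> * of_real \<theta>)" by (rule *(2))
  also have "\<dots> = of_real (exp (c * levy_cumulant \<sigma> \<nu> \<theta>))"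
    unfolding g_def levy_exponent_imaginary[OF \<theta>] by (simp add: exp_of_real[symmetric] del: exp_of_real)
  finally show "(LINT x|M. exp (\<theta> * X x)) = exp (c * levy_cumulant \<sigma> \<nu> \<theta>)"
    by (simp only: of_real_eq_iff)
qed

end

section \<open>Alternating sums over subsets\<close>

text \<open>The pairing of S with \<open>insert j S\<close> reverses the sign and keeps h.\<close>

lemma alternating_sum_Pow_eq_0:
  fixes h :: "'a set \<Rightarrow> 'b::comm_ring_1"
  assumes A: "finite A" "j \<in> A" and h: "\<And>S. S \<subseteq> A - {j} \<Longrightarrow> h (insert j S) = h S"
  shows "(\<Sum>S\<in>Pow A. (- 1) ^ (card A - card S) * h S) = 0"
proof -
  let ?B = "A - {j}"
  let ?t = "\<lambda>S. (- 1) ^ (card A - card S) * h S"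
  have PowA: "Pow A = Pow ?B \<union> insert j ` Pow ?B"
    using A by (subst insert_Diff[OF A(2), symmetric], subst Pow_insert) simp
  have inj: "inj_on (insert j) (Pow ?B)" by (auto simp: inj_on_def)
  have flip: "?t (insert j S) = - ?t S" if S: "S \<subseteq> ?B" for S
  proof -
    have fin: "finite S" using S A finite_subset by blast
    have "card S \<le> card ?B" using S A by (intro card_mono) auto
    also have "\<dots> < card A" using A by (rule card_Diff1_less)
    finally have "card A - card S = Suc (card A - card (insert j S))"
      using fin S by (subst card_insert_disjoint) auto
    then show ?thesis using h[OF S] by simp
  qed
  have "sum ?t (Pow A) = sum ?t (Pow ?B) + sum ?t (insert j ` Pow ?B)"
    unfolding PowA using A by (intro sum.union_disjoint) auto
  also have "sum ?t (insert j ` Pow ?B) = (\<Sum>S\<in>Pow ?B. - ?t S)"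
    unfolding sum.reindex[OF inj] o_def by (rule sum.cong) (use flip in auto)
  finally show ?thesis by (simp add: sum_negf)
qed

lemma alternating_sum_Pow_power:
  fixes x :: "'b::comm_ring_1"
  assumes "finite A"
  shows "(\<Sum>S\<in>Pow A. (- 1) ^ (card A - card S) * x ^ card S) = (x - 1) ^ card A"
  using prod_diff_conv_sum'[OF assms, of "\<lambda>_. x" "\<lambda>_. 1"] by simp

text \<open>The cardinality is a sum of indicators of i in S, and each of them ignores some element
  j other than i.\<close>

lemma alternating_sum_Pow_card:
  assumes A: "finite A" "2 \<le> card A"
  shows "(\<Sum>S\<in>Pow A. (- 1) ^ (card A - card S) * real (card S)) = 0"
proof -
  have "(\<Sum>S\<in>Pow A. (- 1) ^ (card A - card S) * real (card S)) =
      (\<Sum>S\<in>Pow A. \<Sum>i\<in>A. (- 1) ^ (card A - card S) * of_bool (i \<in> S))"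
  proof (rule sum.cong[OF refl])
    fix S assume "S \<in> Pow A"
    then have "real (card S) = (\<Sum>i\<in>A. of_bool (i \<in> S))"
      using A by (simp add: Int_absorb1 flip: Int_def)
    then show "(- 1) ^ (card A - card S) * real (card S) = (\<Sum>i\<in>A. (- 1) ^ (card A - card S) * of_bool (i \<in> S))"
      by (simp only: sum_distrib_left)
  qed
  also have "\<dots> = (\<Sum>i\<in>A. \<Sum>S\<in>Pow A. (- 1) ^ (card A - card S) * of_bool (i \<in> S))"
    by (rule sum.swap)
  also have "\<dots> = 0"
  proof (rule sum.neutral, rule ballI)
    fix i assume "i \<in> A"
    have "\<not> A \<subseteq> {i}" using A card_mono[of "{i}" A] by auto
    then obtain j where "j \<in> A" "j \<noteq> i" by auto
    then show "(\<Sum>S\<in>Pow A. (- 1) ^ (card A - card S) * of_bool (i \<in> S)) = (0::real)"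
      using A by (intro alternating_sum_Pow_eq_0) auto
  qed
  finally show ?thesis .
qed

text \<open>The square counts pairs from S. A pair involves at most two elements, so for three or
  more elements some j is ignored and everything cancels; for two elements the value is 4 - 1 -
  1.\<close>

lemma alternating_sum_Pow_card_square:
  assumes A: "finite A" "2 \<le> card A"
  shows "(\<Sum>S\<in>Pow A. (- 1) ^ (card A - card S) * (real (card S))\<^sup>2) = (if card A = 2 then 2 else 0)"
proof (cases "card A = 2")
  case True
  then obtain a b where ab: "A = {a, b}" "a \<noteq> b" by (auto simp: card_2_iff)
  then have "Pow A = {{}, {a}, {b}, {a, b}}" by auto
  moreover have "{a} \<noteq> {b}" "{a} \<noteq> {a, b}" "{b} \<noteq> {a, b}" using ab by auto
  ultimately show ?thesis using ab by (simp add: power2_eq_square)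
next
  case False
  have "(\<Sum>S\<in>Pow A. (- 1) ^ (card A - card S) * (real (card S))\<^sup>2) =
      (\<Sum>S\<in>Pow A. \<Sum>p\<in>A \<times> A. (- 1) ^ (card A - card S) * of_bool (fst p \<in> S \<and> snd p \<in> S))"
  proof (rule sum.cong[OF refl])
    fix S assume "S \<in> Pow A"
    then have "S \<times> S = A \<times> A \<inter> {p. fst p \<in> S \<and> snd p \<in> S}" by auto
    then have "(real (card S))\<^sup>2 = (\<Sum>p\<in>A \<times> A. of_bool (fst p \<in> S \<and> snd p \<in> S))"
      using A card_cartesian_product[of S S] by (simp add: power2_eq_square)
    then show "(- 1) ^ (card A - card S) * (real (card S))\<^sup>2 =
        (\<Sum>p\<in>A \<times> A. (- 1) ^ (card A - card S) * of_bool (fst p \<in> S \<and> snd p \<in> S))"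
      by (simp only: sum_distrib_left)
  qed
  also have "\<dots> = (\<Sum>p\<in>A \<times> A. \<Sum>S\<in>Pow A. (- 1) ^ (card A - card S) * of_bool (fst p \<in> S \<and> snd p \<in> S))"
    by (rule sum.swap)
  also have "\<dots> = 0"
  proof (rule sum.neutral, rule ballI)
    fix p assume "p \<in> A \<times> A"
    have "\<not> A \<subseteq> {fst p, snd p}"
      using A False card_mono[of "{fst p, snd p}" A] card_insert_le_m1[of 2 "{snd p}" "fst p"] by auto
    then obtain j where "j \<in> A" "j \<noteq> fst p" "j \<noteq> snd p" by auto
    then show "(\<Sum>S\<in>Pow A. (- 1) ^ (card A - card S) * of_bool (fst p \<in> S \<and> snd p \<in> S)) = (0::real)"
      using A by (intro alternating_sum_Pow_eq_0) auto
  qed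
  finally show ?thesis using False by simp
qed

text \<open>This is the n-th finite difference of the cumulant at 0. The exponentials exp(k u)
  combine to the binomial power, the part affine in k drops out, and for n = 2 the value 2 of the
  quadratic difference cancels the factor 1/2 in front of the variance.\<close>

lemma (in levy_moment_measure) alternating_sum_levy_cumulant:
  assumes A: "finite A" "2 \<le> card A" and n: "real (card A) \<le> T"
  shows "(\<Sum>S\<in>Pow A. (- 1) ^ (card A - card S) * levy_cumulant \<sigma> \<nu> (real (card S))) =
    (if card A = 2 then \<sigma>\<^sup>2 else 0) + (LINT u|\<nu>. (exp u - 1) ^ card A)"
proof -
  let ?e = "\<lambda>S. (- 1) ^ (card A - card S) :: real"
  let ?f = "\<lambda>S u. exp (real (card S) * u) - 1 - real (card S) * (exp u - 1)"
  have cS: "real (card S) \<le> T" if "S \<in> Pow A" for S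
    using card_mono[of A S] that A n by simp
  \<comment> \<open>The sum has to be formed under the integral: \<nu> may be infinite near 0, where
    the separate terms of the compensated integrand need not be integrable.\<close>
  have "(\<Sum>S\<in>Pow A. ?e S * (LINT u|\<nu>. ?f S u)) = (LINT u|\<nu>. (\<Sum>S\<in>Pow A. ?e S * ?f S u))"
    using cS integrable_levy_cumulant_kernel by (subst Bochner_Integration.integral_sum) auto
  also have "\<dots> = (LINT u|\<nu>. (exp u - 1) ^ card A)"
  proof (rule Bochner_Integration.integral_cong[OF refl])
    fix u
    have "(\<Sum>S\<in>Pow A. ?e S * ?f S u) = (\<Sum>S\<in>Pow A. ?e S * exp u ^ card S) - (\<Sum>S\<in>Pow A. ?e S * 1 ^ card S)
        - (\<Sum>S\<in>Pow A. ?e S * real (card S)) * (exp u - 1)"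
      unfolding sum_distrib_right sum_subtractf[symmetric]
      by (rule sum.cong[OF refl], simp only: exp_of_nat_mult) (simp add: algebra_simps)
    also have "\<dots> = (exp u - 1) ^ card A"
      unfolding alternating_sum_Pow_power[OF A(1)] alternating_sum_Pow_card[OF A] using A(2) by (cases "card A") auto
    finally show "(\<Sum>S\<in>Pow A. ?e S * ?f S u) = (exp u - 1) ^ card A" .
  qed
  finally have integral: "(\<Sum>S\<in>Pow A. ?e S * (LINT u|\<nu>. ?f S u)) = (LINT u|\<nu>. (exp u - 1) ^ card A)" .
  have "(\<Sum>S\<in>Pow A. ?e S * levy_cumulant \<sigma> \<nu> (real (card S))) =
      \<sigma>\<^sup>2 / 2 * ((\<Sum>S\<in>Pow A. ?e S * (real (card S))\<^sup>2) - (\<Sum>S\<in>Pow A. ?e S * real (card S)))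
      + (\<Sum>S\<in>Pow A. ?e S * (LINT u|\<nu>. ?f S u))"
    unfolding levy_cumulant_def sum_subtractf[symmetric] sum_distrib_left sum.distrib[symmetric]
    by (rule sum.cong) (simp_all add: field_simps)
  then show ?thesis
    unfolding integral alternating_sum_Pow_card[OF A] alternating_sum_Pow_card_square[OF A] by simp
qed

section \<open>Levy spectral measures\<close>

text \<open>Identifies the generated sigma-algebra, so that Borel functions become measurable with
  respect to the Stieltjes measure.\<close>

lemma sets_levy_stieltjes: "sets (levy_stieltjes M) = sets (restrict_space borel (- {0}))"
proof -
  let ?G = "(\<lambda>(a, b). {a<..b}) ` {(a, b). a \<le> b \<and> (b < 0 \<or> 0 < (a::real))}"
  have sets: "sets (levy_stieltjes M) = sigma_sets (- {0}) ?G"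
    unfolding levy_stieltjes_def by (rule sets_extend_measure) auto
  have space: "space (levy_stieltjes M) = - {0}"
    unfolding levy_stieltjes_def by (rule space_extend_measure) auto
  have Ioc: "{a<..b} \<in> sets (levy_stieltjes M)" if "b < 0 \<or> 0 < a" for a b
  proof (cases "a \<le> b")
    case True
    then show ?thesis using that unfolding sets by (intro sigma_sets.Basic) auto
  qed auto
  have neg: "{..a} \<in> sets (levy_stieltjes M)" if "a < 0" for a
  proof -
    have "{..a} = (\<Union>k::nat. {a - real k<..a})"
    proof (intro set_eqI iffI)
      fix x assume "x \<in> {..a}"
      moreover obtain k where "a - x < real k" using reals_Archimedean2 by blast
      ultimately show "x \<in> (\<Union>k::nat. {a - real k<..a})" by (auto intro!: exI[of _ k])
    qed auto
    then show ?thesis using Ioc that by auto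
  qed
  have "(\<lambda>x. x) \<in> borel_measurable (levy_stieltjes M)"
    unfolding borel_measurable_iff_le
  proof
    fix a :: real
    show "{x \<in> space (levy_stieltjes M). x \<le> a} \<in> sets (levy_stieltjes M)"
    proof (cases "a < 0")
      case True
      then have "{x \<in> space (levy_stieltjes M). x \<le> a} = {..a}" by (auto simp: space)
      then show ?thesis using neg True by simp
    next
      case False
      \<comment> \<open>The generating intervals stay on one side of 0, so the punctured half-line
        is exhausted from both sides by sets at distance 1/(k+1) from 0.\<close>
      have "{x \<in> space (levy_stieltjes M). x \<le> a} =
          (\<Union>k. {.. - inverse (real (Suc k))}) \<union> (\<Union>k. {inverse (real (Suc k))<..a})"
      proof (intro set_eqI iffI)
        fix x assume x: "x \<in> {x \<in> space (levy_stieltjes M). x \<le> a}"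
        then have "0 < \<bar>x\<bar>" by (auto simp: space)
        then obtain k where "inverse (real (Suc k)) < \<bar>x\<bar>" using reals_Archimedean by blast
        then show "x \<in> (\<Union>k. {.. - inverse (real (Suc k))}) \<union> (\<Union>k. {inverse (real (Suc k))<..a})"
          using x by (cases "x < 0") (auto intro!: exI[of _ k])
      next
        fix x assume "x \<in> (\<Union>k. {.. - inverse (real (Suc k))}) \<union> (\<Union>k. {inverse (real (Suc k))<..a})"
        then obtain k where k: "x \<le> - inverse (real (Suc k)) \<or> inverse (real (Suc k)) < x \<and> x \<le> a"
          by auto
        have "0 < inverse (real (Suc k))" by simp
        then have "x \<noteq> 0 \<and> x \<le> a" using k False by linarith
        then show "x \<in> {x \<in> space (levy_stieltjes M). x \<le> a}" by (simp add: space)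
      qed
      also have "\<dots> \<in> sets (levy_stieltjes M)"
        by (intro sets.Un sets.countable_UN image_subsetI neg Ioc) auto
      finally show ?thesis .
    qed
  qed
  then have "A \<inter> - {0} \<in> sets (levy_stieltjes M)" if "A \<in> sets borel" for A
    using measurable_sets[of "\<lambda>x. x" "levy_stieltjes M" borel A] that by (simp add: space)
  then have "sets (restrict_space borel (- {0})) \<subseteq> sets (levy_stieltjes M)"
    by (auto simp: sets_restrict_space Int_commute)
  moreover have "sets (levy_stieltjes M) \<subseteq> sets (restrict_space borel (- {0}))"
  proof -
    have "?G \<subseteq> sets (restrict_space borel (- {0}))" by (auto simp: sets_restrict_space_iff)
    then show ?thesis
      unfolding sets using sets.sigma_sets_subset[of ?G "restrict_space borel (- {0})"]
      by (simp add: space_restrict_space)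
  qed
  ultimately show ?thesis by blast
qed

text \<open>A nondecreasing function that tends to 0 at minus infinity is nonnegative on the
  negative axis, so no interval ending at -1 has mass above \<open>M (-1)\<close>.\<close>

lemma emeasure_levy_stieltjes_left_tail:
  assumes M: "levy_spectral_function M"
  shows "emeasure (levy_stieltjes M) {.. -1} < \<infinity>"
proof -
  note M' = M[unfolded levy_spectral_function_def]
  have nonneg: "0 \<le> M x" if "x < 0" for x
  proof (rule tendsto_upperbound)
    show "(M \<longlongrightarrow> 0) at_bot" using M' by blast
    show "\<forall>\<^sub>F y in at_bot. M y \<le> M x"
      using eventually_le_at_bot[of x]
    proof eventually_elim
      case (elim y)
      then show ?case using that M' by (intro mono_onD[of "{..<0}" M]) auto
    qed
  qed simp
  let ?A = "\<lambda>k::nat. {-1 - real k<..-1}"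
  have A: "?A k \<in> sets (levy_stieltjes M)" for k
    unfolding sets_levy_stieltjes by (auto simp: sets_restrict_space_iff)
  have e: "emeasure (levy_stieltjes M) (?A k) \<le> ennreal (M (-1))" for k
    using M' nonneg[of "-1 - real k"]
    by (subst emeasure_levy_stieltjes) (auto intro!: ennreal_leI)
  have "{.. -1} = (\<Union>k. ?A k)"
  proof (intro set_eqI iffI)
    fix x :: real assume "x \<in> {.. -1}"
    moreover obtain k where "-1 - x < real k" using reals_Archimedean2 by blast
    ultimately show "x \<in> (\<Union>k. ?A k)" by (auto intro!: exI[of _ k])
  qed auto
  moreover have "emeasure (levy_stieltjes M) (\<Union>k. ?A k) = (SUP k. emeasure (levy_stieltjes M) (?A k))"
    using A by (intro SUP_emeasure_incseq[symmetric]) (auto simp: incseq_def)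
  moreover have "\<dots> \<le> ennreal (M (-1))" using e by (intro SUP_least)
  ultimately have "emeasure (levy_stieltjes M) {.. -1} \<le> ennreal (M (-1))" by (simp only:)
  also have "\<dots> < \<infinity>" by simp
  finally show ?thesis .
qed

lemma levy_weight_measurable: "levy_weight T \<in> borel_measurable borel"
  unfolding levy_weight_def[abs_def] by measurable

text \<open>The three ranges of the weight are covered by the square integrability near 0, the
  exponential moment and the finite left tail. In the point mass case the weight is integrable at
  once, and c \<noteq> 1 ensures that \<open>ln c\<close> belongs to the punctured line.\<close>

lemma levy_moment_measure_levy_spectral:
  assumes \<nu>: "levy_spectral_measure \<nu>"
    and exp: "set_integrable \<nu> {1<..} (\<lambda>u. exp (T * u))" and T: "1 \<le> T"
  shows "levy_moment_measure \<nu> T"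
proof -
  consider M where "levy_spectral_function M" "\<nu> = levy_stieltjes M"
    | c where "c > 0" "c \<noteq> 1" "\<nu> = return (restrict_space borel (- {0})) (ln c)"
    using \<nu> unfolding levy_spectral_measure_def by blast
  then have "sets \<nu> = sets (restrict_space borel (- {0})) \<and> integrable \<nu> (levy_weight T)"
  proof cases
    case 1
    have sets: "sets \<nu> = sets (restrict_space borel (- {0}))" by (simp add: 1(2) sets_levy_stieltjes)
    have "emeasure \<nu> {..< -1} \<le> emeasure \<nu> {.. -1}"
      unfolding 1(2) by (intro emeasure_mono) (auto simp: sets_levy_stieltjes sets_restrict_space_iff)
    then have "emeasure \<nu> {..< -1} < \<infinity>"
      using emeasure_levy_stieltjes_left_tail[OF 1(1)] 1(2) by (auto elim: le_less_trans)
    then have "integrable \<nu> (indicator {..< -1} :: real \<Rightarrow> real)"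
      by (intro integrable_real_indicator) (auto simp: sets sets_restrict_space_iff)
    moreover have "set_integrable \<nu> ({-1..1} - {0}) (\<lambda>u. u\<^sup>2)"
      using 1 by (simp add: levy_spectral_function_def)
    ultimately have "integrable \<nu> (\<lambda>u. indicator ({-1..1} - {0}) u *\<^sub>R u\<^sup>2 + indicator {1<..} u *\<^sub>R exp (T * u)
        + indicator {..< -1} u)"
      using exp unfolding set_integrable_def by (intro Bochner_Integration.integrable_add) auto
    also have "?this \<longleftrightarrow> integrable \<nu> (levy_weight T)"
    proof (rule Bochner_Integration.integrable_cong[OF refl])
      fix u assume "u \<in> space \<nu>"
      then have "u \<noteq> 0" using sets_eq_imp_space_eq[OF sets] by (auto simp: space_restrict_space)
      then show "indicator ({-1..1} - {0}) u *\<^sub>R u\<^sup>2 + indicator {1<..} u *\<^sub>R exp (T * u) + indicator {..< -1} u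
          = levy_weight T u"
        by (auto simp: levy_weight_def indicator_def)
    qed
    finally show ?thesis using sets by simp
  next
    case 2
    have "ln c \<in> space (restrict_space borel (- {0}))"
      using 2 by (simp add: space_restrict_space)
    moreover have m: "levy_weight T \<in> borel_measurable (restrict_space borel (- {0}))"
      by (rule measurable_restrict_space1[OF levy_weight_measurable])
    ultimately have "(\<integral>\<^sup>+ u. ennreal (norm (levy_weight T u)) \<partial>\<nu>) = ennreal (norm (levy_weight T (ln c)))"
      unfolding 2(3) by (intro nn_integral_return) auto
    then have "integrable \<nu> (levy_weight T)"
      using m unfolding integrable_iff_bounded 2(3) by simp
    then show ?thesis using 2 by simp
  qed
  then show ?thesis using T by (simp add: levy_moment_measure_def)
qed

section \<open>The intensity of the cones\<close>

lemma mem_cone_iff: "\<epsilon> \<le> 1 \<Longrightarrow> (t, l) \<in> cone \<epsilon> s \<longleftrightarrow> \<epsilon> \<le> l \<and> \<bar>t - s\<bar> \<le> min l 1 / 2"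
  by (cases l "1::real" rule: linorder_cases) (simp_all add: cone_def min_def conj_assoc)

section \<open>Derivatives of the logarithm of the profile\<close>

locale profile =
  fixes r :: "real \<Rightarrow> real"
  assumes admissible: "admissible_profile r"
begin

abbreviation lr :: "real \<Rightarrow> real" where "lr \<equiv> \<lambda>z. ln (r z)"

lemma r_pos: "0 < t \<Longrightarrow> t < 1 \<Longrightarrow> 0 < r t"
  using admissible by (auto simp: admissible_profile_def)

lemma iterated_deriv_DERIV:
  assumes "0 < t" "t < 1"
  shows "((deriv ^^ k) r has_real_derivative (deriv ^^ Suc k) r t) (at t)"
  using admissible assms by (auto simp: admissible_profile_def DERIV_deriv_iff_field_differentiable)

lemma lr_DERIV_quotient:
  assumes "0 < t" "t < 1"
  shows "(lr has_real_derivative deriv r t / r t) (at t)"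
  using iterated_deriv_DERIV[OF assms, of 0] r_pos[OF assms] by (auto intro!: derivative_eq_intros)

lemma deriv_lr: "0 < t \<Longrightarrow> t < 1 \<Longrightarrow> deriv lr t = deriv r t / r t"
  by (rule DERIV_imp_deriv[OF lr_DERIV_quotient])

lemma lr_DERIV: "0 < t \<Longrightarrow> t < 1 \<Longrightarrow> (lr has_real_derivative deriv lr t) (at t)"
  using lr_DERIV_quotient[of t] deriv_lr[of t] by simp

lemma deriv_lr_DERIV_quotient:
  assumes t: "0 < t" "t < 1"
  shows "(deriv lr has_real_derivative (deriv (deriv r) t * r t - deriv r t * deriv r t) / (r t * r t)) (at t)"
proof (rule has_field_derivative_transform_within_open[where S = "{0<..<1}"])
  show "((\<lambda>t. deriv r t / r t) has_real_derivative
      (deriv (deriv r) t * r t - deriv r t * deriv r t) / (r t * r t)) (at t)"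
    using iterated_deriv_DERIV[OF t, of 0] iterated_deriv_DERIV[OF t, of 1] r_pos[OF t]
    by (auto intro!: DERIV_divide)
qed (use t deriv_lr in auto)

lemma deriv_deriv_lr:
  "0 < t \<Longrightarrow> t < 1 \<Longrightarrow> deriv (deriv lr) t = (deriv (deriv r) t * r t - deriv r t * deriv r t) / (r t * r t)"
  by (rule DERIV_imp_deriv[OF deriv_lr_DERIV_quotient])

lemma deriv_lr_DERIV: "0 < t \<Longrightarrow> t < 1 \<Longrightarrow> (deriv lr has_real_derivative deriv (deriv lr) t) (at t)"
  using deriv_lr_DERIV_quotient[of t] deriv_deriv_lr[of t] by simp

lemma isCont_deriv_deriv_lr:
  assumes t: "0 < t" "t < 1"
  shows "isCont (deriv (deriv lr)) t"
proof -
  have "isCont (\<lambda>t. (deriv (deriv r) t * r t - deriv r t * deriv r t) / (r t * r t)) t"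
    using r_pos[OF t] DERIV_isCont[OF iterated_deriv_DERIV[OF t, of 0]]
      DERIV_isCont[OF iterated_deriv_DERIV[OF t, of 1]] DERIV_isCont[OF iterated_deriv_DERIV[OF t, of 2]]
    by (intro continuous_intros) (auto simp: numeral_2_eq_2)
  moreover have "\<forall>\<^sub>F t in nhds t. deriv (deriv lr) t = (deriv (deriv r) t * r t - deriv r t * deriv r t) / (r t * r t)"
    using eventually_nhds_in_open[of "{0<..<1}" t] t by (auto elim!: eventually_mono simp: deriv_deriv_lr)
  ultimately show ?thesis by (simp add: isCont_cong)
qed

lemma eventually_at_left_1: "(\<And>t. 0 < t \<Longrightarrow> t < 1 \<Longrightarrow> Q t) \<Longrightarrow> \<forall>\<^sub>F t in at_left (1::real). Q t"
  using eventually_at_left_real[of 0 1] by (auto elim!: eventually_mono)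

lemma lr_tendsto: "(lr \<longlongrightarrow> 0) (at_left 1)"
  using tendsto_ln[of r 1 "at_left 1"] admissible by (simp add: admissible_profile_def)

lemma dlog_eq_deriv:
  assumes "0 < t" "t < 1"
  shows "dlog r t = deriv lr t"
  unfolding dlog_def using lr_DERIV[OF assms]
  by (intro vector_derivative_within)
     (auto simp: has_real_derivative_iff_has_vector_derivative intro: has_vector_derivative_at_within)

text \<open>The left derivative at 1 enters the density above level 1, while integration by parts on
  (m, 1) produces the limit of interior derivatives. L'Hopital's rule identifies the two, so that
  both can cancel later.\<close>

lemma deriv_lr_tendsto: "(deriv lr \<longlongrightarrow> dlog r 1) (at_left 1)"
proof -
  obtain d where d: "(deriv r \<longlongrightarrow> d) (at_left 1)" and r: "(r \<longlongrightarrow> 1) (at_left 1)" and r1: "r 1 = 1"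
    using admissible by (auto simp: admissible_profile_def)
  have "((\<lambda>t. deriv r t / r t) \<longlongrightarrow> d / 1) (at_left 1)" by (intro tendsto_intros d r) simp
  moreover have "\<forall>\<^sub>F t in at_left 1. deriv r t / r t = deriv lr t"
    by (rule eventually_at_left_1) (simp only: deriv_lr)
  ultimately have lim: "(deriv lr \<longlongrightarrow> d) (at_left 1)"
    using Lim_transform_eventually by fastforce
  have "((\<lambda>t. lr t / (t - 1)) \<longlongrightarrow> d) (at_left 1)"
  proof (rule lhopital_left[where f' = "deriv lr" and g' = "\<lambda>_. 1"])
    show "((\<lambda>t::real. t - 1) \<longlongrightarrow> 0) (at_left 1)" by (auto intro!: tendsto_eq_intros)
    show "\<forall>\<^sub>F t in at_left 1. (lr has_real_derivative deriv lr t) (at t)"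
      by (rule eventually_at_left_1) (rule lr_DERIV)
    show "\<forall>\<^sub>F t in at_left 1. t - 1 \<noteq> (0::real)" by (rule eventually_at_left_1) auto
    show "\<forall>\<^sub>F t in at_left 1. ((\<lambda>t. t - 1) has_real_derivative 1) (at t)"
      by (auto intro!: always_eventually derivative_eq_intros)
  qed (use lr_tendsto lim in auto)
  then have "(lr has_real_derivative d) (at_left 1)"
    by (simp add: has_field_derivative_iff r1)
  then have "dlog r 1 = d"
    unfolding dlog_def
    by (intro vector_derivative_within) (auto simp: has_real_derivative_iff_has_vector_derivative)
  then show ?thesis using lim by simp
qed

lemma intensity_density_pos: "0 < l \<Longrightarrow> 0 < intensity_density r l"
  using admissible by (auto simp: admissible_profile_def)

lemma dlog_1_pos: "0 < dlog r 1"
  using intensity_density_pos[of 1] by (simp add: intensity_density_def)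

text \<open>For l \<le> 0 the density is an arbitrary value of iterated \<open>deriv\<close>, hence
  the indicator.\<close>

lemma intensity_density_measurable:
  "(\<lambda>l. indicator {0<..} l * intensity_density r l) \<in> borel_measurable borel"
proof -
  have "continuous_on {0<..<1} (\<lambda>l. - l\<^sup>2 * deriv (deriv lr) l)"
    by (intro continuous_at_imp_continuous_on ballI continuous_intros isCont_deriv_deriv_lr) auto
  then have "(\<lambda>l. indicator {0<..<1} l *\<^sub>R (- l\<^sup>2 * deriv (deriv lr) l) + indicator {1..} l * dlog r 1)
      \<in> borel_measurable borel"
    by (intro borel_measurable_add borel_measurable_continuous_on_indicator) auto
  also have "(\<lambda>l. indicator {0<..<1} l *\<^sub>R (- l\<^sup>2 * deriv (deriv lr) l) + indicator {1..} l * dlog r 1)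
      = (\<lambda>l. indicator {0<..} l * intensity_density r l)"
    by (auto simp: fun_eq_iff intensity_density_def indicator_def)
  finally show ?thesis .
qed

section \<open>The intensity measure evaluated by horizontal slices\<close>

abbreviation half_plane :: "(real \<times> real) set" where "half_plane \<equiv> {(t, l). 0 < l}"

lemma half_plane_borel: "half_plane \<in> sets borel"
proof -
  have "half_plane = UNIV \<times> {0<..}" by auto
  moreover have "open (UNIV \<times> {0<..} :: (real \<times> real) set)" by (intro open_Times) auto
  ultimately show ?thesis by simp
qed

lemma weight_measurable:
  "(\<lambda>l. ennreal (intensity_density r l / l\<^sup>2) * indicator {0<..} l) \<in> borel_measurable borel"
proof -
  have "(\<lambda>l. ennreal ((indicator {0<..} l * intensity_density r l) / l\<^sup>2)) \<in> borel_measurable borel"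
    using intensity_density_measurable by measurable
  also have "(\<lambda>l. ennreal ((indicator {0<..} l * intensity_density r l) / l\<^sup>2)) =
      (\<lambda>l. ennreal (intensity_density r l / l\<^sup>2) * indicator {0<..} l)"
    by (auto simp: fun_eq_iff indicator_def)
  finally show ?thesis .
qed

lemma sets_intensity: "sets (intensity r) = sets (restrict_space borel half_plane)"
  by (simp add: intensity_def cong: restrict_space_sets_cong)

lemma emeasure_intensity:
  assumes A: "A \<in> sets borel" "A \<subseteq> half_plane"
  shows "emeasure (intensity r) A =
    (\<integral>\<^sup>+ l. (ennreal (intensity_density r l / l\<^sup>2) * indicator {0<..} l) * emeasure lborel {t. (t, l) \<in> A} \<partial>lborel)"
proof -
  let ?w = "\<lambda>l. ennreal (intensity_density r l / l\<^sup>2) * indicator {0<..} l"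
  have A': "A \<in> sets (restrict_space lborel half_plane)"
    using A half_plane_borel by (simp add: sets_restrict_space_iff)
  have eq: "(case p of (t, l) \<Rightarrow> ennreal (intensity_density r l / l\<^sup>2)) * indicator half_plane p = ?w (snd p)" for p
    by (auto simp: indicator_def split: prod.splits)
  have wm: "(\<lambda>p. ?w (snd p)) \<in> borel_measurable (borel :: (real \<times> real) measure)"
    using weight_measurable by (rule measurable_compose[rotated]) (simp add: borel_prod[symmetric])
  have "emeasure (intensity r) A =
      (\<integral>\<^sup>+ p. (case p of (t, l) \<Rightarrow> ennreal (intensity_density r l / l\<^sup>2)) * indicator A p \<partial>restrict_space lborel half_plane)"
    unfolding intensity_def
    by (rule emeasure_density[OF _ A'], subst borel_measurable_restrict_space_iff_ennreal)
       (use half_plane_borel wm eq in \<open>simp_all\<close>)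
  also have "\<dots> = (\<integral>\<^sup>+ p. ?w (snd p) * indicator A p \<partial>lborel)"
  proof (subst nn_integral_restrict_space)
    show "half_plane \<inter> space lborel \<in> sets lborel" using half_plane_borel by simp
    show "(\<integral>\<^sup>+ p. (case p of (t, l) \<Rightarrow> ennreal (intensity_density r l / l\<^sup>2)) * indicator A p * indicator half_plane p \<partial>lborel)
        = (\<integral>\<^sup>+ p. ?w (snd p) * indicator A p \<partial>lborel)"
      by (rule nn_integral_cong, subst eq[symmetric]) (simp only: mult_ac)
  qed
  also have "\<dots> = (\<integral>\<^sup>+ l. \<integral>\<^sup>+ t. ?w l * indicator A (t, l) \<partial>lborel \<partial>lborel)"
    using lborel_pair.nn_integral_snd[of "\<lambda>p. ?w (snd p) * indicator A p"] wm A(1)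
    by (simp add: lborel_prod)
  also have "\<dots> = (\<integral>\<^sup>+ l. ?w l * emeasure lborel {t. (t, l) \<in> A} \<partial>lborel)"
  proof (rule nn_integral_cong)
    fix l
    have "(\<lambda>t. (t, l)) -` A \<inter> space borel \<in> sets borel"
      by (rule measurable_sets[OF _ A(1)]) (auto intro!: borel_measurable_continuous_onI continuous_intros)
    then have sl: "{t. (t, l) \<in> A} \<in> sets lborel" by (simp add: vimage_def)
    have "indicator A (t, l) = (indicator {t. (t, l) \<in> A} t :: ennreal)" for t by (simp add: indicator_def)
    then show "(\<integral>\<^sup>+ t. ?w l * indicator A (t, l) \<partial>lborel) = ?w l * emeasure lborel {t. (t, l) \<in> A}"
      using sl by (simp add: nn_integral_cmult)
  qed
  finally show ?thesis .
qed

lemma cone_borel: "cone \<epsilon> s \<in> sets borel"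
proof -
  have "cone \<epsilon> s = {p. \<epsilon> \<le> snd p} \<inter> {p. snd p \<le> 1} \<inter> {p. \<bar>fst p - s\<bar> \<le> snd p / 2} \<union>
      {p. 1 \<le> snd p} \<inter> {p. \<bar>fst p - s\<bar> \<le> 1 / 2}"
    by (auto simp: cone_def)
  moreover have "closed \<dots>"
    by (intro closed_Un closed_Int closed_Collect_le continuous_intros) auto
  ultimately show ?thesis by simp
qed

lemma cone_subset: "0 < \<epsilon> \<Longrightarrow> cone \<epsilon> s \<subseteq> half_plane"
  by (auto simp: cone_def)

lemma cone_sets: "0 < \<epsilon> \<Longrightarrow> cone \<epsilon> s \<in> sets (intensity r)"
  using cone_borel half_plane_borel cone_subset[of \<epsilon> s]
  by (auto simp: sets_intensity sets_restrict_space_iff)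

lemma cone_slice:
  assumes "\<epsilon> \<le> 1" "0 \<le> u"
  shows "{t. (t, l) \<in> cone \<epsilon> s \<inter> cone \<epsilon> (s + u)} =
    (if \<epsilon> \<le> l then {s + u - min l 1 / 2..s + min l 1 / 2} else {})"
proof (rule set_eqI)
  fix t
  have "\<bar>t - s\<bar> \<le> h \<and> \<bar>t - (s + u)\<bar> \<le> h \<longleftrightarrow> s + u - h \<le> t \<and> t \<le> s + h" for h
  proof
    show "\<bar>t - s\<bar> \<le> h \<and> \<bar>t - (s + u)\<bar> \<le> h \<Longrightarrow> s + u - h \<le> t \<and> t \<le> s + h" by linarith
    show "s + u - h \<le> t \<and> t \<le> s + h \<Longrightarrow> \<bar>t - s\<bar> \<le> h \<and> \<bar>t - (s + u)\<bar> \<le> h"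
      using assms(2) by (intro conjI abs_leI) linarith+
  qed
  then show "t \<in> {t. (t, l) \<in> cone \<epsilon> s \<inter> cone \<epsilon> (s + u)} \<longleftrightarrow>
      t \<in> (if \<epsilon> \<le> l then {s + u - min l 1 / 2..s + min l 1 / 2} else {})"
    unfolding mem_Collect_eq Int_iff mem_cone_iff[OF assms(1)] by (cases "\<epsilon> \<le> l") (simp_all only: if_True if_False atLeastAtMost_iff empty_iff simp_thms)
qed

text \<open>At a level l < 1 the weight f(l)/l^2 equals -(log r)''(l), and the slices of two cones
  at distance u overlap in length l - u. The last term of \<open>a\<close> is the boundary
  contribution at level 1; the mass above that level will cancel it.\<close>

lemma nn_integral_density_below_1:
  assumes m: "0 < m" "m < 1" and u: "u \<le> m"
  defines "a \<equiv> (m - u) * deriv lr m - lr m - (1 - u) * dlog r 1"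
  shows "0 \<le> a"
    and "(\<integral>\<^sup>+ l. ennreal (indicator {m<..<1} l *\<^sub>R (- (l - u) * deriv (deriv lr) l)) \<partial>lborel) = ennreal a"
proof -
  let ?h = "\<lambda>l. - (l - u) * deriv (deriv lr) l"
  \<comment> \<open>An explicit antiderivative of \<open>?h\<close>: the two terms with the first
    derivative of \<open>lr\<close> cancel.\<close>
  let ?H = "\<lambda>l. - (l - u) * deriv lr l + lr l"
  have m0: "0 < l" if "m < l" for l using m that by linarith
  have h_nonneg: "0 \<le> ?h l" if l: "m < l" "l < 1" for l
  proof -
    have "0 < - l\<^sup>2 * deriv (deriv lr) l"
      using intensity_density_pos[OF m0[OF l(1)]] l by (simp add: intensity_density_def)
    then have "deriv (deriv lr) l < 0" using m0[OF l(1)] by (simp add: mult_less_0_iff)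
    then show ?thesis using l u by (simp add: mult_nonpos_nonpos)
  qed
  have D: "DERIV ?H l :> ?h l" if "0 < l" "l < 1" for l
  proof -
    have "DERIV (\<lambda>l. - (l - u)) l :> - 1" by (auto intro!: derivative_eq_intros)
    from DERIV_add[OF DERIV_mult[OF this deriv_lr_DERIV[OF that]] lr_DERIV[OF that]]
    show ?thesis by (rule DERIV_cong) (simp add: algebra_simps)
  qed
  \<comment> \<open>The second derivative may be unbounded near 1, so the fundamental theorem is
    used in the form for nonnegative integrands, which delivers integrability too.\<close>
  have FTC: "set_integrable lborel (einterval (ereal m) (ereal 1)) ?h"
    "(LBINT x=ereal m..ereal 1. ?h x) = (- (1 - u) * dlog r 1 + 0) - ?H m"
  proof -
    have 1: "isCont ?h l" if "0 < l" "l < 1" for l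
      using isCont_deriv_deriv_lr[OF that] by (intro continuous_intros) auto
    have 2: "((?H \<circ> real_of_ereal) \<longlongrightarrow> ?H m) (at_right (ereal m))"
      unfolding ereal_tendsto_simps using DERIV_isCont[OF D[OF m]]
      by (simp add: isCont_def filterlim_at_split)
    have 3: "((?H \<circ> real_of_ereal) \<longlongrightarrow> - (1 - u) * dlog r 1 + 0) (at_left (ereal 1))"
      unfolding ereal_tendsto_simps by (intro tendsto_intros deriv_lr_tendsto lr_tendsto)
    show "set_integrable lborel (einterval (ereal m) (ereal 1)) ?h"
      by (rule interval_integral_FTC_nonneg(1)[OF _ _ _ _ 2 3]) (use m D 1 h_nonneg m0 in auto)
    show "(LBINT x=ereal m..ereal 1. ?h x) = (- (1 - u) * dlog r 1 + 0) - ?H m"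
      by (rule interval_integral_FTC_nonneg(2)[OF _ _ _ _ 2 3]) (use m D 1 h_nonneg m0 in auto)
  qed
  have int: "integrable lborel (\<lambda>l. indicator {m<..<1} l *\<^sub>R ?h l)"
    using FTC(1) by (simp add: set_integrable_def)
  have val: "(LINT l|lborel. indicator {m<..<1} l *\<^sub>R ?h l) = a"
    using FTC(2) m by (simp add: interval_lebesgue_integral_def set_lebesgue_integral_def a_def algebra_simps)
  have nonneg: "0 \<le> indicator {m<..<1} l *\<^sub>R ?h l" for l
    using h_nonneg[of l] by (auto simp: indicator_def)
  show "0 \<le> a" unfolding val[symmetric] by (rule Bochner_Integration.integral_nonneg) (rule nonneg)
  show "(\<integral>\<^sup>+ l. ennreal (indicator {m<..<1} l *\<^sub>R ?h l) \<partial>lborel) = ennreal a"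
    unfolding val[symmetric] using nonneg by (intro nn_integral_eq_integral int) auto
qed

lemma nn_integral_density_above_1:
  assumes "0 \<le> c"
  shows "(\<integral>\<^sup>+ l. ennreal (c / l\<^sup>2) * indicator {1..} l \<partial>lborel) = ennreal c"
proof -
  have "((\<lambda>l::real. - c / l) \<longlongrightarrow> 0) at_top" by real_asymp
  then have "(\<integral>\<^sup>+ l. ennreal (c / l\<^sup>2) * indicator {1..} l \<partial>lborel) = ennreal (0 - (- c / 1))"
    using assms
    by (intro nn_integral_FTC_atLeast) (auto intro!: derivative_eq_intros simp: power2_eq_square)
  then show ?thesis by simp
qed

text \<open>Nonnegativity is carried along because \<open>ennreal\<close> truncates negative reals;
  only together do the two parts determine the real-valued measure.\<close>

lemma emeasure_cone_inter_aux:
  assumes \<epsilon>: "0 < \<epsilon>" "\<epsilon> \<le> 1" and u: "0 \<le> u" "u < 1"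
  shows "emeasure (intensity r) (cone \<epsilon> s \<inter> cone \<epsilon> (s + u)) = ennreal (rho_eps r \<epsilon> u) \<and> 0 \<le> rho_eps r \<epsilon> u"
proof -
  \<comment> \<open>The mass starts at this level: below \<epsilon> the cones are empty, below u
    their slices are disjoint.\<close>
  define m where "m = max \<epsilon> u"
  define c where "c = (1 - u) * dlog r 1"
  have m: "0 < m" "m \<le> 1" "u \<le> m" using \<epsilon> u by (auto simp: m_def)
  have c: "0 \<le> c" using u dlog_1_pos by (simp add: c_def)
  let ?w = "\<lambda>l. ennreal (intensity_density r l / l\<^sup>2) * indicator {0<..} l"
  let ?h = "\<lambda>l. indicator {m<..<1} l *\<^sub>R (- (l - u) * deriv (deriv lr) l)"
  let ?A = "cone \<epsilon> s \<inter> cone \<epsilon> (s + u)"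
  have slice: "emeasure lborel {t. (t, l) \<in> ?A} = (if \<epsilon> \<le> l then ennreal (min l 1 - u) else 0)" for l
  proof -
    have "emeasure lborel {s + u - h / 2..s + h / 2} = ennreal (h - u)" for h
      by (cases "u \<le> h") (auto simp: ennreal_neg field_simps)
    then show ?thesis unfolding cone_slice[OF \<epsilon>(2) u(1)] by simp
  qed
  have "emeasure (intensity r) ?A = (\<integral>\<^sup>+ l. ?w l * (if \<epsilon> \<le> l then ennreal (min l 1 - u) else 0) \<partial>lborel)"
    unfolding slice[symmetric] using cone_subset[OF \<epsilon>(1), of s]
    by (intro emeasure_intensity sets.Int cone_borel) blast
  also have "\<dots> = (\<integral>\<^sup>+ l. ennreal (?h l) + ennreal (c / l\<^sup>2) * indicator {1..} l \<partial>lborel)"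
  \<comment> \<open>The level l = m is discarded as a null set, because \<open>?h\<close> lives on
    an open interval.\<close>
  proof (rule nn_integral_cong_AE, rule AE_mp[OF AE_lborel_singleton[of m]], intro AE_I2 impI)
    fix l assume "l \<noteq> m"
    then consider "l < \<epsilon>" | "\<epsilon> \<le> l" "l < u" | "m < l" "l < 1" | "1 \<le> l" using m by (force simp: m_def)
    then show "?w l * (if \<epsilon> \<le> l then ennreal (min l 1 - u) else 0) =
        ennreal (?h l) + ennreal (c / l\<^sup>2) * indicator {1..} l"
    proof cases
      case 1
      then show ?thesis using \<epsilon> by (auto simp: m_def)
    next
      case 2
      then show ?thesis using u by (auto simp: m_def ennreal_neg)
    next
      case 3
      then have "0 < l" "u < l" "\<epsilon> \<le> l" using m by (auto simp: m_def)
      moreover have "intensity_density r l / l\<^sup>2 = - deriv (deriv lr) l"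
        using 3 \<open>0 < l\<close> by (simp add: intensity_density_def)
      moreover have "0 \<le> intensity_density r l / l\<^sup>2"
        using intensity_density_pos[OF \<open>0 < l\<close>] by simp
      ultimately show ?thesis
        using 3 by (simp add: min_def ennreal_mult[symmetric]) (simp add: algebra_simps)
    next
      case 4
      then show ?thesis
        using \<epsilon> u dlog_1_pos by (simp add: intensity_density_def c_def min_def ennreal_mult[symmetric] mult_ac)
    qed
  qed
  also have "\<dots> = (\<integral>\<^sup>+ l. ennreal (?h l) \<partial>lborel) + (\<integral>\<^sup>+ l. ennreal (c / l\<^sup>2) * indicator {1..} l \<partial>lborel)"
  proof (rule nn_integral_add)
    have "continuous_on {m<..<1} (\<lambda>l. - (l - u) * deriv (deriv lr) l)"
      using m by (intro continuous_at_imp_continuous_on ballI continuous_intros isCont_deriv_deriv_lr) auto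
    then have "?h \<in> borel_measurable borel"
      by (intro borel_measurable_continuous_on_indicator) auto
    then show "(\<lambda>l. ennreal (?h l)) \<in> borel_measurable lborel" by measurable
  qed measurable
  finally have *: "emeasure (intensity r) ?A = (\<integral>\<^sup>+ l. ennreal (?h l) \<partial>lborel) + ennreal c"
    using nn_integral_density_above_1[OF c] by simp
  show ?thesis
  proof (cases "m = 1")
    \<comment> \<open>Since u < 1, this is the case \<epsilon> = 1: there is no mass below level
      1.\<close>
    case True
    then have "\<epsilon> = 1" using u by (auto simp: m_def max_def split: if_splits)
    moreover have "r 1 = 1" using admissible by (simp add: admissible_profile_def)
    ultimately have "rho_eps r \<epsilon> u = c" using u by (simp add: rho_eps_def c_def)
    then show ?thesis using * True c by simp
  next
    case False
    then have m1: "m < 1" using m by simp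
    note a = nn_integral_density_below_1[OF m(1) m1 m(3)]
    \<comment> \<open>The two branches of \<open>rho_eps\<close> are the two values of the maximum:
      for m = u the derivative term vanishes, for m = \<epsilon> it is the linear
      interpolation.\<close>
    have rho: "rho_eps r \<epsilon> u = ((m - u) * deriv lr m - lr m - (1 - u) * dlog r 1) + c"
    proof (cases "u < \<epsilon>")
      case True
      then have "m = \<epsilon>" by (simp add: m_def)
      moreover have "dlog r \<epsilon> = deriv lr \<epsilon>"
        using m1 \<epsilon> by (intro dlog_eq_deriv) (auto simp: m_def)
      ultimately show ?thesis using True u \<epsilon> by (simp add: rho_eps_def c_def field_simps)
    next
      case False
      then have "m = u" by (simp add: m_def)
      then show ?thesis using False u \<epsilon> by (simp add: rho_eps_def c_def)
    qed
    show ?thesis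
      unfolding rho * a(2) using a(1) c by (simp add: ennreal_plus)
  qed
qed

lemmas emeasure_cone_inter = emeasure_cone_inter_aux[THEN conjunct1]
  and rho_eps_nonneg = emeasure_cone_inter_aux[THEN conjunct2]

lemma emeasure_cone_finite:
  assumes "0 < \<epsilon>" "\<epsilon> \<le> 1"
  shows "emeasure (intensity r) (cone \<epsilon> s) < \<infinity>"
  using emeasure_cone_inter[OF assms, of 0 s] by simp

lemma measure_cone_inter:
  assumes "0 < \<epsilon>" "\<epsilon> \<le> 1" "0 \<le> u" "u < 1"
  shows "measure (intensity r) (cone \<epsilon> s \<inter> cone \<epsilon> (s + u)) = rho_eps r \<epsilon> u"
  unfolding measure_def using emeasure_cone_inter[OF assms, of s] rho_eps_nonneg[OF assms] by simp

end

section \<open>Independence of atoms\<close>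

text \<open>The points lying in \<open>A i\<close> exactly for the i in J, among the indices of I.
  For empty J the intersection is the whole type, which is why J = {} is always excluded.\<close>

definition atom :: "'i set \<Rightarrow> ('i \<Rightarrow> 'b set) \<Rightarrow> 'i set \<Rightarrow> 'b set" where
  "atom I A J = (\<Inter>i\<in>J. A i) - (\<Union>i\<in>I - J. A i)"

text \<open>The constant sequence of empty sets is disjoint, and a summable constant series is zero.
  This permits padding finite families to the sequences required by the axioms.\<close>

lemma id_random_measure_empty_AE:
  assumes "id_random_measure \<Omega> \<rho> \<mu> \<phi> P"
  shows "AE x in \<Omega>. P {} x = 0"
proof -
  have "AE x in \<Omega>. (\<lambda>i::nat. P {} x) sums P (\<Union>i::nat. {}) x"
    using assms unfolding id_random_measure_def
    by (elim conjE allE[of _ "\<lambda>_::nat. {}"]) (auto simp: disjoint_family_on_def)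
  then show ?thesis
  proof eventually_elim
    case (elim x)
    then have "summable (\<lambda>i::nat. P {} x)" by (rule sums_summable)
    then show ?case by (simp add: summable_const_iff)
  qed
qed

lemma id_random_measure_exponential_moment:
  assumes \<nu>: "levy_moment_measure \<nu> T"
    and P: "id_random_measure \<Omega> \<rho> \<mu> (levy_exponent \<sigma> \<nu>) P" and \<mu>: "0 \<le> \<mu>"
    and A: "A \<in> sets \<rho>" "emeasure \<rho> A < \<infinity>" and \<theta>: "0 \<le> \<theta>" "\<theta> \<le> T"
  shows "P A \<in> borel_measurable \<Omega>"
    and "integrable \<Omega> (\<lambda>x. exp (\<theta> * P A x))"
    and "(LINT x|\<Omega>. exp (\<theta> * P A x)) = exp (\<mu> * (measure \<rho> A * levy_cumulant \<sigma> \<nu> \<theta>))"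
proof -
  interpret levy_moment_measure \<nu> T by fact
  interpret prob_space \<Omega> using P by (simp add: id_random_measure_def)
  define B where "B i = (if i = 0 then A else {})" for i :: nat
  have "indep_vars (\<lambda>_. borel) (\<lambda>i::nat. P (B i)) UNIV"
    using P A unfolding id_random_measure_def
    by (elim conjE allE[of _ B]) (auto simp: disjoint_family_on_def B_def split: if_splits)
  then have "P (B 0) \<in> borel_measurable \<Omega>" by (auto simp: indep_vars_def)
  then show meas: "P A \<in> borel_measurable \<Omega>" by (simp add: B_def)
  have "char (distr \<Omega> borel (P A)) q = exp (of_real (\<mu> * measure \<rho> A) * levy_exponent \<sigma> \<nu> (of_real q))" for q
    using P A by (simp add: id_random_measure_def mult_ac)
  note * = exponential_moment[OF prob_space_axioms meas _ this \<theta>]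
  show "integrable \<Omega> (\<lambda>x. exp (\<theta> * P A x))" using *(1) \<mu> by simp
  show "(LINT x|\<Omega>. exp (\<theta> * P A x)) = exp (\<mu> * (measure \<rho> A * levy_cumulant \<sigma> \<nu> \<theta>))"
    using *(2) \<mu> by (simp add: mult.assoc)
qed

text \<open>Overlapping sets give dependent values of \<open>P\<close>; their atoms are disjoint, so
  the expectation factorises over atoms, each appearing with the number of chosen sets that contain
  it.\<close>

lemma joint_exponential_moment:
  fixes A :: "'i \<Rightarrow> 'b set"
  assumes \<nu>: "levy_moment_measure \<nu> T"
    and P: "id_random_measure \<Omega> \<rho> \<mu> (levy_exponent \<sigma> \<nu>) P" and \<mu>: "0 \<le> \<mu>"
    and I: "finite I" "real (card I) \<le> T" and S: "S \<subseteq> I"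
    and A: "\<And>i. i \<in> I \<Longrightarrow> A i \<in> sets \<rho>" "\<And>i. i \<in> I \<Longrightarrow> emeasure \<rho> (A i) < \<infinity>"
  shows "integrable \<Omega> (\<lambda>x. exp (\<Sum>i\<in>S. P (A i) x))"
    and "(LINT x|\<Omega>. exp (\<Sum>i\<in>S. P (A i) x)) =
      exp (\<mu> * (\<Sum>J\<in>Pow I - {{}}. measure \<rho> (atom I A J) * levy_cumulant \<sigma> \<nu> (real (card (S \<inter> J)))))"
proof -
  interpret prob_space \<Omega> using P by (simp add: id_random_measure_def)
  define N where "N = card (Pow I - {{}})"
  obtain h where h: "bij_betw h {..<N} (Pow I - {{}})"
    using ex_bij_betw_nat_finite[of "Pow I - {{}}"] I by (auto simp: N_def atLeast0LessThan)
  have hI: "h j \<subseteq> I" "h j \<noteq> {}" if "j < N" for j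
    using bij_betwE[OF h] that by auto
  \<comment> \<open>The nonempty index sets are enumerated by h, and the sequence is continued by
    empty sets.\<close>
  define C where "C j = (if j < N then atom I A (h j) else {})" for j
  have finI: "finite J" if "J \<subseteq> I" for J using that I(1) finite_subset by blast
  have atom_sub: "atom I A J \<subseteq> A i" if "i \<in> J" for i J using that by (auto simp: atom_def)
  have C_sets: "C j \<in> sets \<rho>" "emeasure \<rho> (C j) < \<infinity>" for j
  proof -
    show *: "C j \<in> sets \<rho>"
      unfolding C_def atom_def using A(1) hI[of j] finI by (auto intro!: sets.Diff sets.finite_INT sets.finite_UN)
    show "emeasure \<rho> (C j) < \<infinity>"
    proof (cases "j < N")
      case True
      then obtain i where i: "i \<in> h j" "i \<in> I" using hI[of j] by blast
      then have "emeasure \<rho> (C j) \<le> emeasure \<rho> (A i)"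
        using atom_sub True A(1) by (intro emeasure_mono) (auto simp: C_def)
      then show ?thesis using A(2)[OF i(2)] by (rule le_less_trans)
    qed (simp add: C_def)
  qed
  have atom_disj: "atom I A J \<inter> atom I A K = {}" if JK: "J \<subseteq> I" "K \<subseteq> I" "J \<noteq> K" for J K
  proof -
    obtain i where "i \<in> J - K \<or> i \<in> K - J" using JK by blast
    then show ?thesis using JK by (auto simp: atom_def)
  qed
  have C_disj: "disjoint_family C"
    unfolding disjoint_family_on_def
  proof (intro ballI impI)
    fix j k :: nat assume "j \<noteq> k"
    show "C j \<inter> C k = {}"
    proof (cases "j < N \<and> k < N")
      case True
      then have "h j \<noteq> h k"
        using \<open>j \<noteq> k\<close> inj_onD[OF bij_betw_imp_inj_on[OF h], of j k] by auto
      then show ?thesis using True by (simp add: C_def atom_disj hI)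
    qed (auto simp: C_def)
  qed
  have indep: "indep_vars (\<lambda>_. borel) (\<lambda>j::nat. P (C j)) UNIV"
    using P C_sets C_disj unfolding id_random_measure_def by (elim conjE allE[of _ C]) auto
  \<comment> \<open>\<open>A i\<close> is the disjoint union of the atoms whose index set contains
    i. Additivity and the vanishing on the padding hold only almost surely, and so does this
    formula.\<close>
  have decomp: "AE x in \<Omega>. P (A i) x = (\<Sum>j<N. of_bool (i \<in> h j) * P (C j) x)" if i: "i \<in> I" for i
  proof -
    define D where "D j = (if j < N \<and> i \<in> h j then C j else {})" for j
    have UD: "(\<Union>j. D j) = A i"
    proof (intro set_eqI iffI)
      fix x assume "x \<in> A i"
      define J where "J = {k \<in> I. x \<in> A k}"
      have "J \<in> Pow I - {{}}" using \<open>x \<in> A i\<close> i by (auto simp: J_def)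
      then obtain j where j: "j < N" "h j = J"
        using bij_betw_imp_surj_on[OF h] by (metis imageE lessThan_iff)
      have "x \<in> D j" using j \<open>x \<in> A i\<close> i by (auto simp: D_def C_def atom_def J_def)
      then show "x \<in> (\<Union>j. D j)" by blast
    next
      fix x assume "x \<in> (\<Union>j. D j)"
      then show "x \<in> A i" using atom_sub by (fastforce simp: D_def C_def split: if_splits)
    qed
    have "range D \<subseteq> {A \<in> sets \<rho>. emeasure \<rho> A < \<infinity>}" using C_sets by (auto simp: D_def)
    moreover have "disjoint_family D"
      using C_disj by (auto simp: D_def disjoint_family_on_def)
    ultimately have "AE x in \<Omega>. (\<lambda>j. P (D j) x) sums P (A i) x"
      using P A(2)[OF i] unfolding id_random_measure_def UD[symmetric] by blast
    then show ?thesis using id_random_measure_empty_AE[OF P]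
    proof eventually_elim
      case (elim x)
      have "(\<lambda>j. P (D j) x) sums (\<Sum>j<N. P (D j) x)"
        using elim(2) by (intro sums_finite) (auto simp: D_def)
      then have "P (A i) x = (\<Sum>j<N. P (D j) x)" using elim(1) sums_unique2 by blast
      also have "\<dots> = (\<Sum>j<N. of_bool (i \<in> h j) * P (C j) x)"
        using elim(2) by (intro sum.cong) (auto simp: D_def)
      finally show ?case .
    qed
  qed
  have "AE x in \<Omega>. \<forall>i\<in>S. P (A i) x = (\<Sum>j<N. of_bool (i \<in> h j) * P (C j) x)"
    using decomp S finI[OF S] by (intro AE_finite_allI) auto
  \<comment> \<open>Exchanging the two sums collects each atom with multiplicity
    \<open>card (S \<inter> h j)\<close>, which never exceeds \<open>T\<close>.\<close>
  then have AE_eq: "AE x in \<Omega>. exp (\<Sum>i\<in>S. P (A i) x) = (\<Prod>j<N. exp (real (card (S \<inter> h j)) * P (C j) x))"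
  proof eventually_elim
    case (elim x)
    have "(\<Sum>i\<in>S. P (A i) x) = (\<Sum>i\<in>S. \<Sum>j<N. of_bool (i \<in> h j) * P (C j) x)"
      using elim by simp
    also have "\<dots> = (\<Sum>j<N. \<Sum>i\<in>S. of_bool (i \<in> h j) * P (C j) x)" by (rule sum.swap)
    also have "\<dots> = (\<Sum>j<N. real (card (S \<inter> h j)) * P (C j) x)"
      using finI[OF S] by (simp flip: sum_distrib_right)
    finally show ?case by (simp add: exp_sum)
  qed
  have T: "real (card (S \<inter> J)) \<le> T" for J
  proof -
    have "card (S \<inter> J) \<le> card I" using S by (intro card_mono I(1)) auto
    then show ?thesis using I(2) by linarith
  qed
  note moment = id_random_measure_exponential_moment[OF \<nu> P \<mu> C_sets of_nat_0_le_iff T]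
  have indep': "indep_vars (\<lambda>_. borel) (\<lambda>j x. exp (real (card (S \<inter> h j)) * P (C j) x)) {..<N}"
    by (rule indep_vars_compose2[OF indep_vars_subset[OF indep]]) auto
  have meas: "(\<lambda>x. exp (\<Sum>i\<in>S. P (A i) x)) \<in> borel_measurable \<Omega>"
  proof -
    have [measurable]: "P (A i) \<in> borel_measurable \<Omega>" if "i \<in> S" for i
      using that S A \<nu> by (intro id_random_measure_exponential_moment(1)[OF \<nu> P \<mu>, of _ 0])
        (auto simp: levy_moment_measure_def)
    show ?thesis by measurable
  qed
  have int: "integrable \<Omega> (\<lambda>x. \<Prod>j<N. exp (real (card (S \<inter> h j)) * P (C j) x))"
    using moment(2) by (intro indep_vars_integrable indep') auto
  show "integrable \<Omega> (\<lambda>x. exp (\<Sum>i\<in>S. P (A i) x))"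
    using AE_eq by (intro integrable_cong_AE_imp[OF int meas]) (auto elim: eventually_mono)
  have "(LINT x|\<Omega>. exp (\<Sum>i\<in>S. P (A i) x)) = (LINT x|\<Omega>. (\<Prod>j<N. exp (real (card (S \<inter> h j)) * P (C j) x)))"
    by (rule integral_cong_AE[OF meas borel_measurable_integrable[OF int] AE_eq])
  also have "\<dots> = (\<Prod>j<N. (LINT x|\<Omega>. exp (real (card (S \<inter> h j)) * P (C j) x)))"
    using moment(2) by (intro indep_vars_lebesgue_integral indep') auto
  also have "\<dots> = exp (\<mu> * (\<Sum>j<N. measure \<rho> (C j) * levy_cumulant \<sigma> \<nu> (real (card (S \<inter> h j)))))"
    by (simp only: moment(3) exp_sum[symmetric] finite_lessThan sum_distrib_left)
  also have "(\<Sum>j<N. measure \<rho> (C j) * levy_cumulant \<sigma> \<nu> (real (card (S \<inter> h j)))) =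
      (\<Sum>j<N. measure \<rho> (atom I A (h j)) * levy_cumulant \<sigma> \<nu> (real (card (S \<inter> h j))))"
    by (simp add: C_def)
  also have "\<dots> = (\<Sum>J\<in>Pow I - {{}}. measure \<rho> (atom I A J) * levy_cumulant \<sigma> \<nu> (real (card (S \<inter> J))))"
    by (rule sum.reindex_bij_betw[OF h])
  finally show "(LINT x|\<Omega>. exp (\<Sum>i\<in>S. P (A i) x)) =
      exp (\<mu> * (\<Sum>J\<in>Pow I - {{}}. measure \<rho> (atom I A J) * levy_cumulant \<sigma> \<nu> (real (card (S \<inter> J)))))" .
qed

section \<open>The extension variable and its independence of the field\<close>

lemma (in prob_space) indep_set_mono:
  assumes "indep_set A B" "A' \<subseteq> A" "B' \<subseteq> B"
  shows "indep_set A' B'"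
  using assms unfolding indep_set_def
  by (elim indep_sets_mono_sets) (auto split: bool.split)

text \<open>Independence is given between the sigma-algebra of \<open>Z\<close> and that of the
  whole process; a function of the coordinates in V is measurable for the latter, so independence
  descends to it.\<close>

lemma (in prob_space) indep_var_if_independent_of_process:
  fixes F :: "real \<Rightarrow> real" and G :: "(real \<Rightarrow> real) \<Rightarrow> real"
  assumes ind: "independent_of_process M Z W"
    and Z: "Z \<in> borel_measurable M" and F: "F \<in> borel_measurable borel"
    and W: "\<And>v. v \<in> V \<Longrightarrow> W v \<in> borel_measurable M"
    and G: "G \<in> borel_measurable (PiM V (\<lambda>_. borel))"
  shows "indep_var borel (\<lambda>x. F (Z x)) borel (\<lambda>x. G (\<lambda>v\<in>V. W v x))"
proof -
  let ?Z = "vimage_algebra (space M) Z borel"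
  let ?W = "vimage_algebra (space M) (\<lambda>x u. W u x) (Pi\<^sub>M UNIV (\<lambda>_. borel))"
  have FZ: "(\<lambda>x. F (Z x)) \<in> borel_measurable ?Z"
    by (rule measurable_compose[OF measurable_vimage_algebra1 F]) simp
  have proc: "(\<lambda>x u. W u x) \<in> measurable ?W (Pi\<^sub>M UNIV (\<lambda>_. borel))"
    by (rule measurable_vimage_algebra1) (simp add: space_PiM)
  have "W v \<in> borel_measurable ?W" for v
    using measurable_compose[OF proc measurable_component_singleton[of v UNIV "\<lambda>_. borel"]] by simp
  then have GW: "(\<lambda>x. G (\<lambda>v\<in>V. W v x)) \<in> borel_measurable ?W"
    by (intro measurable_compose[OF measurable_restrict G]) auto
  have sub: "sigma_sets (space M) {X -` A \<inter> space M |A. A \<in> sets borel} \<subseteq> sets N"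
    if X: "X \<in> borel_measurable N" "space N = space M" for X :: "'a \<Rightarrow> real" and N
  proof -
    have "{X -` A \<inter> space M |A. A \<in> sets borel} \<subseteq> sets N"
      using measurable_sets[OF X(1)] X(2) by auto
    from sets.sigma_sets_subset[OF this] show ?thesis by (simp only: X(2))
  qed
  have "indep_set (sets ?Z) (sets ?W)" using ind by (simp add: independent_of_process_def)
  then have "indep_set (sigma_sets (space M) {(\<lambda>x. F (Z x)) -` A \<inter> space M |A. A \<in> sets borel})
      (sigma_sets (space M) {(\<lambda>x. G (\<lambda>v\<in>V. W v x)) -` A \<inter> space M |A. A \<in> sets borel})"
    by (rule indep_set_mono[OF _ sub[OF FZ] sub[OF GW]]) simp_all
  moreover have "(\<lambda>x. G (\<lambda>v\<in>V. W v x)) \<in> borel_measurable M"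
    by (intro measurable_compose[OF measurable_restrict G]) (use W in auto)
  ultimately show ?thesis
    unfolding indep_var_eq using measurable_compose[OF Z F] by blast
qed

text \<open>\<open>Z\<close> is shared by all points, so it acts like one further atom, of mass
  \<open>ln L\<close>, contained in every cone; 1 \<le> L makes this mass nonnegative.\<close>

lemma extended_field_exponential_moment:
  fixes s :: "'i \<Rightarrow> real"
  assumes \<nu>: "levy_moment_measure \<nu> T"
    and P: "id_random_measure \<Omega> \<rho> \<mu> (levy_exponent \<sigma> \<nu>) P" and \<mu>: "0 \<le> \<mu>"
    and Z: "extension_variable \<Omega> \<mu> (levy_exponent \<sigma> \<nu>) L (id_field P \<epsilon>) Z" and L: "1 \<le> L"
    and I: "finite I" "real (card I) \<le> T" and S: "S \<subseteq> I"
    and A: "\<And>i. i \<in> I \<Longrightarrow> cone \<epsilon> (s i) \<in> sets \<rho>" "\<And>i. i \<in> I \<Longrightarrow> emeasure \<rho> (cone \<epsilon> (s i)) < \<infinity>"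
  defines "\<Lambda> \<equiv> (\<Sum>J\<in>Pow I - {{}}. measure \<rho> (atom I (\<lambda>i. cone \<epsilon> (s i)) J) * levy_cumulant \<sigma> \<nu> (real (card (S \<inter> J))))
      + ln L * levy_cumulant \<sigma> \<nu> (real (card S))"
  shows "integrable \<Omega> (\<lambda>x. \<Prod>i\<in>S. exp (extended_field P Z \<epsilon> (s i) x))"
    and "(LINT x|\<Omega>. (\<Prod>i\<in>S. exp (extended_field P Z \<epsilon> (s i) x))) = exp (\<mu> * \<Lambda>)"
proof -
  interpret levy_moment_measure \<nu> T by fact
  interpret prob_space \<Omega> using P by (simp add: id_random_measure_def)
  have finS: "finite S" using S I(1) by (rule finite_subset)
  let ?W = "\<lambda>x. exp (\<Sum>i\<in>S. P (cone \<epsilon> (s i)) x)"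
  let ?Z = "\<lambda>x. exp (real (card S) * Z x)"
  note W = joint_exponential_moment[where A = "\<lambda>i. cone \<epsilon> (s i)", OF \<nu> P \<mu> I S A]
  have Zm: "Z \<in> borel_measurable \<Omega>" and ind: "independent_of_process \<Omega> Z (id_field P \<epsilon>)"
    using Z unfolding extension_variable_def by blast+
  have charZ: "char (distr \<Omega> borel Z) q = exp (of_real (\<mu> * ln L) * levy_exponent \<sigma> \<nu> (of_real q))" for q
    using Z by (simp add: extension_variable_def mult_ac)
  have cS: "real (card S) \<le> T" using card_mono[OF I(1) S] I(2) by linarith
  have "0 \<le> \<mu> * ln L" using \<mu> L by simp
  note Zmom = exponential_moment[OF prob_space_axioms Zm this charZ of_nat_0_le_iff cS]
  have Pm: "P (cone \<epsilon> (s i)) \<in> borel_measurable \<Omega>" if "i \<in> S" for i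
    using that S A T by (intro id_random_measure_exponential_moment(1)[OF \<nu> P \<mu>, of _ 0]) auto
  have "indep_var borel (\<lambda>x. exp (real (card S) * Z x)) borel
      (\<lambda>x. (\<lambda>w. exp (\<Sum>i\<in>S. w (s i))) (\<lambda>v\<in>s ` S. id_field P \<epsilon> v x))"
    by (rule indep_var_if_independent_of_process[OF ind Zm, where F = "\<lambda>z. exp (real (card S) * z)"])
       (use Pm in \<open>auto simp: id_field_def\<close>)
  then have indep: "indep_var borel ?Z borel ?W" by (simp add: id_field_def)
  have eq: "(\<Prod>i\<in>S. exp (extended_field P Z \<epsilon> (s i) x)) = ?Z x * ?W x" for x
  proof -
    have "(\<Sum>i\<in>S. extended_field P Z \<epsilon> (s i) x) = real (card S) * Z x + (\<Sum>i\<in>S. P (cone \<epsilon> (s i)) x)"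
      by (simp add: extended_field_def id_field_def sum.distrib)
    then show ?thesis by (simp only: exp_sum[OF finS, symmetric] exp_add)
  qed
  show "integrable \<Omega> (\<lambda>x. \<Prod>i\<in>S. exp (extended_field P Z \<epsilon> (s i) x))"
    unfolding eq by (intro indep_var_integrable indep Zmom W)
  have "(LINT x|\<Omega>. (\<Prod>i\<in>S. exp (extended_field P Z \<epsilon> (s i) x))) = (LINT x|\<Omega>. ?Z x) * (LINT x|\<Omega>. ?W x)"
    unfolding eq by (intro indep_var_lebesgue_integral indep Zmom W)
  then show "(LINT x|\<Omega>. (\<Prod>i\<in>S. exp (extended_field P Z \<epsilon> (s i) x))) = exp (\<mu> * \<Lambda>)"
    unfolding \<Lambda>_def distrib_left exp_add by (simp only: Zmom(2) W(2)) (simp only: mult_ac)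
qed

section \<open>First-order expansion\<close>

text \<open>For J \<noteq> I some j in I - J can be toggled in S without changing
  \<open>S \<inter> J\<close>. The constant c plays the part of additional mass on the full index
  set.\<close>

lemma alternating_sum_atoms:
  fixes m h :: "_ \<Rightarrow> real"
  assumes I: "finite I" "I \<noteq> {}"
  shows "(\<Sum>S\<in>Pow I. (- 1) ^ (card I - card S) *
      ((\<Sum>J\<in>Pow I - {{}}. m J * h (card (S \<inter> J))) + c * h (card S))) =
    (m I + c) * (\<Sum>S\<in>Pow I. (- 1) ^ (card I - card S) * h (card S))"
proof -
  let ?e = "\<lambda>S. (- 1) ^ (card I - card S) :: real"
  have "(\<Sum>S\<in>Pow I. ?e S * (\<Sum>J\<in>Pow I - {{}}. m J * h (card (S \<inter> J)))) =
      (\<Sum>J\<in>Pow I - {{}}. m J * (\<Sum>S\<in>Pow I. ?e S * h (card (S \<inter> J))))"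
    unfolding sum_distrib_left by (subst sum.swap) (simp only: mult.left_commute)
  also have "\<dots> = (\<Sum>J\<in>{I}. m J * (\<Sum>S\<in>Pow I. ?e S * h (card (S \<inter> J))))"
  proof (rule sum.mono_neutral_right)
    show "\<forall>J\<in>Pow I - {{}} - {I}. m J * (\<Sum>S\<in>Pow I. ?e S * h (card (S \<inter> J))) = 0"
    proof
      fix J assume "J \<in> Pow I - {{}} - {I}"
      then obtain j where j: "j \<in> I" "j \<notin> J" by auto
      have "(\<Sum>S\<in>Pow I. ?e S * h (card (S \<inter> J))) = 0"
        by (rule alternating_sum_Pow_eq_0[OF I(1) j(1)]) (use j in simp)
      then show "m J * (\<Sum>S\<in>Pow I. ?e S * h (card (S \<inter> J))) = 0" by simp
    qed
  qed (use I in auto)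
  also have "\<dots> = m I * (\<Sum>S\<in>Pow I. ?e S * h (card S))"
    by (auto intro!: sum.cong arg_cong2[where f = "(*)"] simp: Int_absorb2)
  finally show ?thesis
    unfolding distrib_left sum.distrib distrib_right sum_distrib_left[of c] by (simp add: mult_ac)
qed

lemma exp_quotient_tendsto: "((\<lambda>\<delta>. (exp (\<delta> * a) - 1) / \<delta>) \<longlongrightarrow> a) (at_right (0::real))"
proof -
  have "((\<lambda>\<delta>. exp (\<delta> * a)) has_real_derivative a) (at 0)"
    by (auto intro!: derivative_eq_intros)
  then have "((\<lambda>\<delta>. (exp (\<delta> * a) - 1) / \<delta>) \<longlongrightarrow> a) (at 0)" by (simp add: DERIV_def)
  then show ?thesis by (rule tendsto_mono[rotated]) (rule at_le, simp)
qed

text \<open>No rate is assumed in c S \<longlongrightarrow> 1: the sum of the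
  \<open>c S \<delta>\<close> is kept exactly, and the remaining term already carries a factor
  \<delta>, so replacing its coefficient by the limit costs only o(\<delta>).\<close>

lemma first_order_smallo:
  fixes c :: "'i \<Rightarrow> real \<Rightarrow> real" and e a :: "'i \<Rightarrow> real"
  assumes c: "\<And>S. S \<in> X \<Longrightarrow> (c S \<longlongrightarrow> 1) (at_right 0)"
  shows "(\<lambda>\<delta>. (\<Sum>S\<in>X. e S * (c S \<delta> * exp (\<delta> * a S))) -
      ((\<Sum>S\<in>X. e S * c S \<delta>) + \<delta> * (\<Sum>S\<in>X. e S * a S))) \<in> o[at_right 0](\<lambda>\<delta>. \<delta>)"
proof -
  have "(\<lambda>\<delta>. \<Sum>S\<in>X. e S * (c S \<delta> * (exp (\<delta> * a S) - 1) - \<delta> * a S)) \<in> o[at_right 0](\<lambda>\<delta>. \<delta>)"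
  proof (rule big_sum_in_smallo)
    fix S assume S: "S \<in> X"
    have "((\<lambda>\<delta>. e S * (c S \<delta> * ((exp (\<delta> * a S) - 1) / \<delta>) - a S)) \<longlongrightarrow> e S * (1 * a S - a S)) (at_right 0)"
      by (intro tendsto_intros c[OF S] exp_quotient_tendsto)
    moreover have "\<forall>\<^sub>F \<delta> in at_right 0. e S * (c S \<delta> * ((exp (\<delta> * a S) - 1) / \<delta>) - a S) =
        e S * (c S \<delta> * (exp (\<delta> * a S) - 1) - \<delta> * a S) / \<delta>"
      by (rule eventually_mono[OF eventually_at_right_less[of 0]]) (simp add: field_simps)
    ultimately have "((\<lambda>\<delta>. e S * (c S \<delta> * (exp (\<delta> * a S) - 1) - \<delta> * a S) / \<delta>) \<longlongrightarrow> 0) (at_right 0)"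
      by (auto intro: Lim_transform_eventually)
    then show "(\<lambda>\<delta>. e S * (c S \<delta> * (exp (\<delta> * a S) - 1) - \<delta> * a S)) \<in> o[at_right 0](\<lambda>\<delta>. \<delta>)"
      by (rule smalloI_tendsto) (auto intro: eventually_mono[OF eventually_at_right_less[of 0]])
  qed
  also have "(\<lambda>\<delta>. \<Sum>S\<in>X. e S * (c S \<delta> * (exp (\<delta> * a S) - 1) - \<delta> * a S)) =
      (\<lambda>\<delta>. (\<Sum>S\<in>X. e S * (c S \<delta> * exp (\<delta> * a S))) -
      ((\<Sum>S\<in>X. e S * c S \<delta>) + \<delta> * (\<Sum>S\<in>X. e S * a S)))"
    unfolding sum_distrib_left sum.distrib[symmetric] sum_subtractf[symmetric]
    by (rule ext, rule sum.cong) (simp_all add: algebra_simps)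
  finally show ?thesis .
qed

text \<open>At each level the slices are intervals of equal width centred at the s i, so a point in
  both extreme ones lies in all of them.\<close>

lemma Inter_cone:
  fixes s :: "nat \<Rightarrow> real"
  assumes s: "strict_mono_on {1..n} s" and n: "2 \<le> n" and \<epsilon>: "\<epsilon> \<le> 1"
  shows "(\<Inter>i\<in>{1..n}. cone \<epsilon> (s i)) = cone \<epsilon> (s 1) \<inter> cone \<epsilon> (s n)"
proof (intro equalityI subsetI INT_I)
  fix p i assume p: "p \<in> cone \<epsilon> (s 1) \<inter> cone \<epsilon> (s n)" and i: "i \<in> {1..n}"
  have mono: "s j \<le> s k" if "1 \<le> j" "j \<le> k" "k \<le> n" for j k :: nat
    using s that by (cases "j = k") (auto intro!: less_imp_le strict_mono_onD[OF s])
  obtain t l where tl: "p = (t, l)" by force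
  have "s 1 \<le> s i" "s i \<le> s n" using mono i by auto
  then show "p \<in> cone \<epsilon> (s i)"
    using p unfolding tl Int_iff mem_cone_iff[OF \<epsilon>] by linarith
qed (use n in auto)

theorem lemma4p2:
  fixes \<sigma> L \<epsilon> :: real
    and \<nu> :: "real measure"
    and r :: "real \<Rightarrow> real"
    and \<Omega> :: "real \<Rightarrow> 'a measure"
    and P :: "real \<Rightarrow> (real \<times> real) set \<Rightarrow> 'a \<Rightarrow> real"
    and Z :: "real \<Rightarrow> 'a \<Rightarrow> real"
    and \<omega> :: "real \<Rightarrow> real \<Rightarrow> 'a \<Rightarrow> real"
    and f :: "real \<Rightarrow> real \<Rightarrow> real"
    and n :: nat
    and s :: "nat \<Rightarrow> real"
  assumes levy: "levy_spectral_measure \<nu>"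
    and moments: "set_integrable \<nu> {1<..} (\<lambda>u. exp (real n * u))"
    and profile: "admissible_profile r"
    and L: "1 \<le> L"
    and eps: "0 < \<epsilon>" "\<epsilon> \<le> 1"
    and P: "\<And>\<delta>. 0 < \<delta> \<Longrightarrow>
      id_random_measure (\<Omega> \<delta>) (intensity r) \<delta> (levy_exponent \<sigma> \<nu>) (P \<delta>)"
    and Z: "\<And>\<delta>. 0 < \<delta> \<Longrightarrow>
      extension_variable (\<Omega> \<delta>) \<delta> (levy_exponent \<sigma> \<nu>) L (id_field (P \<delta>) \<epsilon>) (Z \<delta>)"
    and field: "\<And>\<delta>. 0 < \<delta> \<Longrightarrow> \<omega> \<delta> = extended_field (P \<delta>) (Z \<delta>) \<epsilon>"
    and f_cont: "continuous_on ({0<..} \<times> {0<..<1}) (\<lambda>(\<delta>, t). f \<delta> t)"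
    and f_vanish: "\<And>t. 0 < t \<Longrightarrow> t < 1 \<Longrightarrow> ((\<lambda>\<delta>. f \<delta> t) \<longlongrightarrow> 0) (at_right 0)"
    and n: "2 \<le> n"
    and s: "strict_mono_on {1..n} s" "\<And>i. i \<in> {1..n} \<Longrightarrow> 0 < s i \<and> s i < 1"
  shows "(n = 2 \<longrightarrow>
      (\<lambda>\<delta>. (LINT x|\<Omega> \<delta>. calB f \<omega> \<delta> (s 1) x * calB f \<omega> \<delta> (s 2) x)
          - ((exp (f \<delta> (s 1)) - 1) * (exp (f \<delta> (s 2)) - 1)
             + \<delta> * rho_L_eps r L \<epsilon> (s 2 - s 1) * (\<sigma>\<^sup>2 + (LINT u|\<nu>. (exp u - 1)\<^sup>2))))
        \<in> o[at_right 0](\<lambda>\<delta>. \<delta>)) \<and>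
    (n > 2 \<longrightarrow>
      (\<lambda>\<delta>. (LINT x|\<Omega> \<delta>. (\<Prod>i=1..n. calB f \<omega> \<delta> (s i) x))
          - ((\<Prod>i=1..n. (exp (f \<delta> (s i)) - 1))
             + \<delta> * rho_L_eps r L \<epsilon> (s n - s 1) * (LINT u|\<nu>. (exp u - 1) ^ n)))
        \<in> o[at_right 0](\<lambda>\<delta>. \<delta>))"
proof -
  have prof: "profile r" using profile by (rule profile.intro)
  have \<nu>: "levy_moment_measure \<nu> (real n)"
    using levy_moment_measure_levy_spectral[OF levy moments] n by simp
  define I where "I = {1..n}"
  define e where "e S = (- 1 :: real) ^ (card I - card S)" for S :: "nat set"
  have I: "finite I" "card I = n" "I \<noteq> {}" using n by (auto simp: I_def)
  define m where "m J = measure (intensity r) (atom I (\<lambda>i. cone \<epsilon> (s i)) J)" for J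
  define \<Lambda> where "\<Lambda> S = (\<Sum>J\<in>Pow I - {{}}. m J * levy_cumulant \<sigma> \<nu> (real (card (S \<inter> J))))
      + ln L * levy_cumulant \<sigma> \<nu> (real (card S))" for S
  define c where "c S \<delta> = (\<Prod>i\<in>S. exp (f \<delta> (s i)))" for S \<delta>
  \<comment> \<open>One constant for both cases; the conditional is what remains of the Gaussian
    part after n differences.\<close>
  define K where "K = (if n = 2 then \<sigma>\<^sup>2 else 0) + (LINT u|\<nu>. (exp u - 1) ^ n)"
  have "s 1 < s n" "0 < s 1" "s n < 1"
    using s n strict_mono_onD[OF s(1), of 1 n] by auto
  \<comment> \<open>For the full index set the atom removes an empty union and is the intersection
    of all cones, hence of the two extreme ones.\<close>
  then have "m I = rho_eps r \<epsilon> (s n - s 1)"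
    using profile.measure_cone_inter[OF prof eps, of "s n - s 1" "s 1"] Inter_cone[OF s(1) n eps(2)]
    by (simp add: m_def atom_def I_def)
  then have sum_\<Lambda>: "(\<Sum>S\<in>Pow I. e S * \<Lambda> S) = rho_L_eps r L \<epsilon> (s n - s 1) * K"
    using levy_moment_measure.alternating_sum_levy_cumulant[OF \<nu> I(1), of \<sigma>] n I(2)
      alternating_sum_atoms[OF I(1,3), of m "\<lambda>k. levy_cumulant \<sigma> \<nu> (real k)" "ln L"]
    by (simp add: e_def \<Lambda>_def K_def rho_L_eps_def add.commute)
  have E: "(LINT x|\<Omega> \<delta>. (\<Prod>i\<in>I. calB f \<omega> \<delta> (s i) x)) = (\<Sum>S\<in>Pow I. e S * (c S \<delta> * exp (\<delta> * \<Lambda> S)))"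
    if \<delta>: "0 < \<delta>" for \<delta>
  proof -
    let ?W = "\<lambda>S x. \<Prod>i\<in>S. exp (extended_field (P \<delta>) (Z \<delta>) \<epsilon> (s i) x)"
    have cones: "cone \<epsilon> (s i) \<in> sets (intensity r)" "emeasure (intensity r) (cone \<epsilon> (s i)) < \<infinity>" for i
      using profile.cone_sets[OF prof eps(1)] profile.emeasure_cone_finite[OF prof eps] by auto
    have W: "integrable (\<Omega> \<delta>) (?W S)" "(LINT x|\<Omega> \<delta>. ?W S x) = exp (\<delta> * \<Lambda> S)" if "S \<in> Pow I" for S
      using extended_field_exponential_moment[OF \<nu> P[OF \<delta>] less_imp_le[OF \<delta>] Z[OF \<delta>] L I(1) _ _ cones, of S] that I(2)
      by (auto simp: \<Lambda>_def m_def)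
    have "(\<Prod>i\<in>I. calB f \<omega> \<delta> (s i) x) = (\<Sum>S\<in>Pow I. (e S * c S \<delta>) * ?W S x)" for x
      unfolding calB_def prod_diff_conv_sum'[OF I(1)]
      by (simp add: e_def c_def field[OF \<delta>] exp_add prod.distrib mult.assoc)
    then have "(LINT x|\<Omega> \<delta>. (\<Prod>i\<in>I. calB f \<omega> \<delta> (s i) x)) = (\<Sum>S\<in>Pow I. (e S * c S \<delta>) * (LINT x|\<Omega> \<delta>. ?W S x))"
      using W(1) by (simp add: Bochner_Integration.integral_sum)
    then show ?thesis using W(2) by (simp add: mult.assoc)
  qed
  have c_lim: "(c S \<longlongrightarrow> 1) (at_right 0)" if "S \<in> Pow I" for S
  proof -
    have "(c S \<longlongrightarrow> (\<Prod>i\<in>S. exp 0)) (at_right 0)"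
      unfolding c_def using that s(2) by (intro tendsto_prod tendsto_exp f_vanish) (auto simp: I_def)
    then show ?thesis by simp
  qed
  have prod_eq: "(\<Sum>S\<in>Pow I. e S * c S \<delta>) = (\<Prod>i\<in>I. (exp (f \<delta> (s i)) - 1))" for \<delta>
    unfolding prod_diff_conv_sum'[OF I(1)] by (simp add: e_def c_def)
  have "(\<lambda>\<delta>. (\<Sum>S\<in>Pow I. e S * (c S \<delta> * exp (\<delta> * \<Lambda> S))) -
      ((\<Prod>i\<in>I. (exp (f \<delta> (s i)) - 1)) + \<delta> * (rho_L_eps r L \<epsilon> (s n - s 1) * K))) \<in> o[at_right 0](\<lambda>\<delta>. \<delta>)"
    using first_order_smallo[of "Pow I" c e \<Lambda>, OF c_lim] by (simp only: prod_eq sum_\<Lambda>)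
  \<comment> \<open>The subset formula is available for \<delta> > 0 only, which is all that
    \<open>at_right 0\<close> sees.\<close>
  then have main: "(\<lambda>\<delta>. (LINT x|\<Omega> \<delta>. (\<Prod>i\<in>I. calB f \<omega> \<delta> (s i) x)) -
      ((\<Prod>i\<in>I. (exp (f \<delta> (s i)) - 1)) + \<delta> * (rho_L_eps r L \<epsilon> (s n - s 1) * K))) \<in> o[at_right 0](\<lambda>\<delta>. \<delta>)"
    by (rule landau_o.small.in_cong[THEN iffD1, rotated])
       (rule eventually_mono[OF eventually_at_right_less[of 0]], simp add: E)
  show ?thesis
  proof (intro conjI impI)
    assume n2: "n = 2"
    have "I = {1, 2}" using n2 by (auto simp: I_def)
    then have "(\<Prod>i\<in>I. g i) = g 1 * g 2" for g :: "nat \<Rightarrow> real" by simp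
    then show "(\<lambda>\<delta>. (LINT x|\<Omega> \<delta>. calB f \<omega> \<delta> (s 1) x * calB f \<omega> \<delta> (s 2) x)
          - ((exp (f \<delta> (s 1)) - 1) * (exp (f \<delta> (s 2)) - 1)
             + \<delta> * rho_L_eps r L \<epsilon> (s 2 - s 1) * (\<sigma>\<^sup>2 + (LINT u|\<nu>. (exp u - 1)\<^sup>2))))
        \<in> o[at_right 0](\<lambda>\<delta>. \<delta>)"
      using main n2 by (simp add: K_def mult.assoc)
  next
    assume "n > 2"
    then show "(\<lambda>\<delta>. (LINT x|\<Omega> \<delta>. (\<Prod>i=1..n. calB f \<omega> \<delta> (s i) x))
          - ((\<Prod>i=1..n. (exp (f \<delta> (s i)) - 1))
             + \<delta> * rho_L_eps r L \<epsilon> (s n - s 1) * (LINT u|\<nu>. (exp u - 1) ^ n)))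
        \<in> o[at_right 0](\<lambda>\<delta>. \<delta>)"
      using main by (simp add: K_def I_def mult.assoc)
  qed
qed

end
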